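(* Let $\Bbbk$ be a field, let $G=(V,E)$ be an $n$-cycle, and let $\mathcal{I}$ be the set of principal ideals of $R=\Bbbk[x,y]$ of the form $\langle(x+ay)^2\rangle$ with $a\in\Bbbk$. Let $\alpha\colon E\to\mathcal{I}$ be an edge-labeling of $G$. Then the module of splines $R_{G,\alpha}$ has a homogeneous basis over $R$ of the following form, and the degree sequence of $(G,\alpha)$ is as follows: (1) If $(G,\alpha)$ has exactly one distinct edge-label: one generator of degree $0$ and $n-1$ generators of degree $2$; the degree sequence is $(1,0,n-1)$. (2) If $(G,\alpha)$ has exactly two distinct edge-labels: one generator of degree $0$, $n-2$ of degree $2$, and one of degree $4$; the degree sequence is $(1,0,n-2,0,1)$. (3) If $(G,\alpha)$ has three or more distinct edge-labels: one generator of degree $0$, $n-3$ of degree $2$, and two of degree $3$; the degree sequence is $(1,0,n-3,2)$.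
   Context: An edge-labeling of a graph $G=(V,E)$ is a function $\alpha$ from $E$ to a set of ideals of $R$. A (generalized) spline on $(G,\alpha)$ is a vector $\mathbf{p}\in\bigoplus_{v\in V}R$ with $\mathbf{p}_u-\mathbf{p}_v\in\alpha(uv)$ for every edge $uv\in E$; the set $R_{G,\alpha}$ of splines is an $R$-module under coordinatewise operations. A minimum generating set (MGS) is a generating set of the $R$-module $R_{G,\alpha}$ such that no other generating set has fewer elements. An MGS (or basis) is homogeneous if for each of its elements $\mathbf{b}$ all nonzero entries of $\mathbf{b}$ are homogeneous polynomials of one and the same degree, denoted $\deg\mathbf{b}$. The degree sequence of a homogeneous MGS $\mathcal{B}$ is $(d_0,d_1,d_2,\dots)$ where $d_j$ is the number of $\mathbf{b}\in\mathcal{B}$ with $\deg\mathbf{b}=j$ (trailing zeros are omitted); it does not depend on the choice of homogeneous MGS and is called the degree sequence of $(G,\alpha)$.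
   Formalization: Part (3) is stated only for fields of characteristic different from 2; in characteristic 2, (x+ay)^2 = x^2+a^2y^2, and with three or more labels the degree sequence is (1,0,n-2,0,1), so part (3) always fails there. *)

theory Defs
  imports
    "HOL-Computational_Algebra.Computational_Algebra"
    "HOL-Library.Function_Algebras"
    "HOL-Library.FuncSet"
begin

definition cycle_graph :: "nat \<Rightarrow> 'v set \<Rightarrow> 'v set set \<Rightarrow> bool" where
  "cycle_graph n V E \<longleftrightarrow> n \<ge> 3 \<and>
     (\<exists>c. bij_betw c {..<n} V \<and> E = (\<lambda>i. {c i, c (Suc i mod n)}) ` {..<n})"

text \<open>The free module over \<open>R\<close> on a finite vertex set \<open>V\<close> is rendered as the set of functions
  vanishing outside \<open>V\<close>; addition comes from \<^theory>\<open>HOL-Library.Function_Algebras\<close>.\<close>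

definition vec_scale :: "'r::comm_ring_1 \<Rightarrow> ('v \<Rightarrow> 'r) \<Rightarrow> 'v \<Rightarrow> 'r" where
  "vec_scale r p = (\<lambda>v. r * p v)"

lemma module_vec_scale: "module vec_scale"
  by unfold_locales (auto simp: vec_scale_def fun_eq_iff algebra_simps)

definition splines ::
    "'v set \<Rightarrow> 'v set set \<Rightarrow> ('v set \<Rightarrow> 'r::comm_ring_1 set) \<Rightarrow> ('v \<Rightarrow> 'r) set" where
  "splines V E \<alpha> =
     {p. (\<forall>v. v \<notin> V \<longrightarrow> p v = 0) \<and> (\<forall>u v. {u, v} \<in> E \<longrightarrow> p u - p v \<in> \<alpha> {u, v})}"

lemma subspace_splines:
  assumes "\<And>e. e \<in> E \<Longrightarrow> module.subspace (*) (\<alpha> e)"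
  shows "module.subspace vec_scale (splines V E \<alpha>)"
proof -
  interpret R: module "(*) :: 'b \<Rightarrow> 'b \<Rightarrow> 'b"
    by unfold_locales (auto simp: algebra_simps)
  interpret M: module "vec_scale :: 'b \<Rightarrow> ('a \<Rightarrow> 'b) \<Rightarrow> _" by (rule module_vec_scale)
  show ?thesis
    unfolding M.subspace_def
  proof (intro conjI ballI allI)
    show "0 \<in> splines V E \<alpha>"
      using assms by (auto simp: splines_def R.subspace_0)
  next
    fix p q assume p: "p \<in> splines V E \<alpha>" and q: "q \<in> splines V E \<alpha>"
    have "(p u + q u) - (p v + q v) \<in> \<alpha> {u, v}" if e: "{u, v} \<in> E" for u v
    proof -
      have "(p u - p v) + (q u - q v) \<in> \<alpha> {u, v}"
        using p q e by (intro R.subspace_add assms) (auto simp: splines_def)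
      then show ?thesis by (simp add: add_diff_add)
    qed
    with p q show "p + q \<in> splines V E \<alpha>" by (auto simp: splines_def)
  next
    fix r p assume p: "p \<in> splines V E \<alpha>"
    have "r * p u - r * p v \<in> \<alpha> {u, v}" if e: "{u, v} \<in> E" for u v
    proof -
      have "r * (p u - p v) \<in> \<alpha> {u, v}"
        using p e by (intro R.subspace_scale assms) (auto simp: splines_def)
      then show ?thesis by (simp add: right_diff_distrib)
    qed
    with p show "vec_scale r p \<in> splines V E \<alpha>"
      by (auto simp: splines_def vec_scale_def)
  qed
qed

definition generating_set :: "('v \<Rightarrow> 'r::comm_ring_1) set \<Rightarrow> ('v \<Rightarrow> 'r) set \<Rightarrow> bool" where
  "generating_set M B \<longleftrightarrow> module.span vec_scale B = M"

text \<open>Only finitely generated modules are considered, so a generating set with the least number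
  of elements is finite, and only finite competitors matter (\<^const>\<open>card\<close> is 0 on infinite sets).\<close>

definition minimum_generating_set ::
    "('v \<Rightarrow> 'r::comm_ring_1) set \<Rightarrow> ('v \<Rightarrow> 'r) set \<Rightarrow> bool" where
  "minimum_generating_set M B \<longleftrightarrow> finite B \<and> generating_set M B \<and>
     (\<forall>C. finite C \<longrightarrow> generating_set M C \<longrightarrow> card B \<le> card C)"

definition module_basis :: "('v \<Rightarrow> 'r::comm_ring_1) set \<Rightarrow> ('v \<Rightarrow> 'r) set \<Rightarrow> bool" where
  "module_basis M B \<longleftrightarrow> generating_set M B \<and> \<not> module.dependent vec_scale B"

text \<open>The polynomial ring \<open>k[x,y]\<close> is \<open>'k poly poly\<close>: the inner indeterminate is \<open>x\<close>, the outer one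
  is \<open>y\<close>, so the coefficient of \<open>x^i y^j\<close> in \<open>p\<close> is \<open>coeff (coeff p j) i\<close>.\<close>

definition var_x :: "'k::field poly poly" where
  "var_x = [:[:0, 1:]:]"

definition var_y :: "'k::field poly poly" where
  "var_y = [:0, 1:]"

definition scalar :: "'k::field \<Rightarrow> 'k poly poly" where
  "scalar a = [:[:a:]:]"

definition linear_square_ideals :: "'k::field poly poly set set" where
  "linear_square_ideals = {module.span (*) {(var_x + scalar a * var_y) ^ 2} | a. True}"

definition homogeneous_poly :: "nat \<Rightarrow> 'k::field poly poly \<Rightarrow> bool" where
  "homogeneous_poly d p \<longleftrightarrow> (\<forall>i j. coeff (coeff p j) i \<noteq> 0 \<longrightarrow> i + j = d)"

text \<open>The zero polynomial satisfies \<^const>\<open>homogeneous_poly\<close> for every degree, so zero entries of a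
  vector are unconstrained. The degree of a vector is determined only if the vector is nonzero, which
  holds for every element of a basis or of a minimum generating set.\<close>

definition homogeneous_vec :: "nat \<Rightarrow> ('v \<Rightarrow> 'k::field poly poly) \<Rightarrow> bool" where
  "homogeneous_vec d b \<longleftrightarrow> (\<forall>v. homogeneous_poly d (b v))"

definition vec_degree :: "('v \<Rightarrow> 'k::field poly poly) \<Rightarrow> nat" where
  "vec_degree b = (THE d. homogeneous_vec d b)"

definition homogeneous_set :: "('v \<Rightarrow> 'k::field poly poly) set \<Rightarrow> bool" where
  "homogeneous_set B \<longleftrightarrow> (\<forall>b\<in>B. \<exists>d. homogeneous_vec d b)"

text \<open>For finite nonempty \<open>B\<close>, stopping at the largest occurring degree omits precisely the
  trailing zeros.\<close>

definition degree_list :: "('v \<Rightarrow> 'k::field poly poly) set \<Rightarrow> nat list" where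
  "degree_list B =
     map (\<lambda>j. card {b \<in> B. vec_degree b = j}) [0..<Suc (Max (vec_degree ` B))]"

text \<open>As a relation, so that existence of a homogeneous minimum generating set and independence of
  its choice are part of the meaning.\<close>

definition has_degree_sequence ::
    "'v set \<Rightarrow> 'v set set \<Rightarrow> ('v set \<Rightarrow> 'k::field poly poly set) \<Rightarrow> nat list \<Rightarrow> bool" where
  "has_degree_sequence V E \<alpha> ds \<longleftrightarrow>
     (\<exists>B. minimum_generating_set (splines V E \<alpha>) B \<and> homogeneous_set B) \<and>
     (\<forall>B. minimum_generating_set (splines V E \<alpha>) B \<and> homogeneous_set B \<longrightarrow> degree_list B = ds)"

end

theory Submission
  imports Defs
begin

text \<open>A spline on the cycle is determined by its value at one vertex and by the multiples
  \<open>q i * h i\<close> of the edge labels \<open>q i\<close> by which it changes along the edges; these must add up to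
  zero. So the spline module is \<open>R\<close> plus the syzygies of the \<open>n\<close> labels. A label that is a scalar
  combination of some chosen labels contributes a syzygy of degree 0, hence a spline of degree 2,
  and what remains are the syzygies of the chosen ones: none for a single square, the Koszul
  syzygy of degree 2 for two coprime squares, and, as three distinct squares span all quadratic
  forms if \<open>2 \<noteq> 0\<close>, two linear syzygies for three of them.

  For any homogeneous basis and any homogeneous minimum generating set, the elements of degree at
  most \<open>d\<close> on either side generate the same submodule, so their numbers agree by rank.\<close>

section \<open>Rank over a domain\<close>

interpretation vec: module "vec_scale :: 'r::comm_ring_1 \<Rightarrow> ('v \<Rightarrow> 'r) \<Rightarrow> 'v \<Rightarrow> 'r"
  by (rule module_vec_scale)

lemma vector_space_vec_scale:
  "vector_space (vec_scale :: 'r::field \<Rightarrow> ('v \<Rightarrow> 'r) \<Rightarrow> 'v \<Rightarrow> 'r)"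
  using module_vec_scale module_iff_vector_space by blast

lemma sum_fun_apply: "(\<Sum>x\<in>A. f x) v = (\<Sum>x\<in>A. f x v)"
  by (induction A rule: infinite_finite_induct) auto

lemma vec_scale_apply [simp]: "vec_scale r p v = r * p v"
  by (simp add: vec_scale_def)

lemma to_fract_sum: "to_fract (\<Sum>x\<in>A. f x) = (\<Sum>x\<in>A. to_fract (f x))"
  by (induction A rule: infinite_finite_induct) auto

lemma common_denominator:
  fixes f :: "'a \<Rightarrow> 'r::idom fract"
  assumes "finite A"
  shows "\<exists>d r. d \<noteq> 0 \<and> (\<forall>x\<in>A. to_fract d * f x = to_fract (r x))"
  using assms
proof induction
  case empty
  then show ?case by (auto intro!: exI[of _ 1])
next
  case (insert a A)
  then obtain d r where d: "d \<noteq> 0" "\<forall>x\<in>A. to_fract d * f x = to_fract (r x)" by blast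
  obtain n e where e: "f a = Fract n e" "e \<noteq> 0" by (cases "f a")
  have "to_fract (d * e) * f x = to_fract (if x = a then d * n else e * r x)"
    if "x \<in> insert a A" for x
  proof (cases "x = a")
    case True
    then show ?thesis using e by (simp add: Fract_conv_to_fract)
  next
    case False
    then have "to_fract d * f x = to_fract (r x)" using that d by auto
    then show ?thesis using False by (simp add: mult_ac)
  qed
  moreover have "d * e \<noteq> 0" using d e by simp
  ultimately show ?case
    by (intro exI[of _ "d * e"] exI[of _ "\<lambda>x. if x = a then d * n else e * r x"]) blast
qed

text \<open>The embedding into the vector space over the fraction field, where the exchange lemma
  gives cardinality bounds. Rank statements over the domain are transported along it.\<close>

definition fract_vec :: "('v \<Rightarrow> 'r::idom) \<Rightarrow> 'v \<Rightarrow> 'r fract" where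
  "fract_vec p = to_fract \<circ> p"

lemma inj_fract_vec: "inj fract_vec"
  by (auto simp: inj_def fract_vec_def fun_eq_iff)

lemma fract_vec_lincomb:
  "fract_vec (\<Sum>b\<in>B. vec_scale (r b) b) = (\<Sum>b\<in>B. vec_scale (to_fract (r b)) (fract_vec b))"
  by (rule ext) (simp add: fract_vec_def sum_fun_apply to_fract_sum)

lemma fract_vec_eq_0_iff: "fract_vec p = 0 \<longleftrightarrow> p = 0"
  by (auto simp: fract_vec_def fun_eq_iff)

lemma sum_fract_vec_image:
  "(\<Sum>b\<in>fract_vec ` B. g b) = (\<Sum>b\<in>B. g (fract_vec b))"
  by (subst sum.reindex) (auto intro: inj_on_subset[OF inj_fract_vec])

text \<open>A relation over the fraction field becomes one over the domain after multiplication by a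
  common denominator, which is nonzero and so keeps some coefficient nonzero. The converse carries
  the coefficients along the injective embedding.\<close>

lemma dependent_fract_vec_iff:
  fixes B :: "('v \<Rightarrow> 'r::idom) set"
  assumes "finite B"
  shows "module.dependent vec_scale (fract_vec ` B) \<longleftrightarrow> module.dependent vec_scale B"
proof
  assume "module.dependent vec_scale (fract_vec ` B)"
  then obtain u where u: "\<exists>b\<in>B. u (fract_vec b) \<noteq> 0"
    "(\<Sum>b\<in>B. vec_scale (u (fract_vec b)) (fract_vec b)) = 0"
    using assms by (auto simp: vec.dependent_finite sum_fract_vec_image)
  obtain d r where d: "d \<noteq> 0" "\<forall>b\<in>B. to_fract d * u (fract_vec b) = to_fract (r b)"
    using common_denominator[OF assms, of "\<lambda>b. u (fract_vec b)"] by blast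
  have "fract_vec (\<Sum>b\<in>B. vec_scale (r b) b)
      = (\<Sum>b\<in>B. vec_scale (to_fract d * u (fract_vec b)) (fract_vec b))"
    unfolding fract_vec_lincomb using d by (intro sum.cong) auto
  also have "\<dots> = vec_scale (to_fract d) (\<Sum>b\<in>B. vec_scale (u (fract_vec b)) (fract_vec b))"
    by (simp add: vec.scale_sum_right)
  also have "\<dots> = 0" by (simp add: u)
  finally have "(\<Sum>b\<in>B. vec_scale (r b) b) = 0"
    by (simp add: fract_vec_eq_0_iff)
  moreover have "\<exists>b\<in>B. r b \<noteq> 0"
    using u(1) d by (metis mult_eq_0_iff to_fract_eq_0_iff)
  ultimately show "module.dependent vec_scale B"
    using assms by (auto simp: vec.dependent_finite)
next
  assume "module.dependent vec_scale B"
  then obtain u where u: "\<exists>b\<in>B. u b \<noteq> 0" "(\<Sum>b\<in>B. vec_scale (u b) b) = 0"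
    using assms by (auto simp: vec.dependent_finite)
  let ?u = "\<lambda>x. to_fract (u (inv fract_vec x))"
  have "(\<Sum>b\<in>fract_vec ` B. vec_scale (?u b) b) = 0"
    using u(2)
    by (simp add: sum_fract_vec_image inv_f_f[OF inj_fract_vec] fract_vec_eq_0_iff flip: fract_vec_lincomb)
  moreover have "\<exists>b\<in>fract_vec ` B. ?u b \<noteq> 0"
    using u(1) by (auto simp: inv_f_f[OF inj_fract_vec])
  ultimately show "module.dependent vec_scale (fract_vec ` B)"
    unfolding vec.dependent_finite[OF finite_imageI[OF assms]] by (intro exI conjI)
qed

lemma fract_vec_in_span:
  assumes "finite C" "p \<in> module.span vec_scale C"
  shows "fract_vec p \<in> module.span vec_scale (fract_vec ` C)"
proof -
  obtain u where "p = (\<Sum>c\<in>C. vec_scale (u c) c)"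
    using assms by (auto simp: vec.span_finite)
  then show ?thesis
    by (auto simp: fract_vec_lincomb intro!: vec.span_sum vec.span_scale intro: vec.span_base)
qed

text \<open>Passing to fractions keeps \<open>B\<close> independent and inside the span of
  \<open>C\<close>, so the exchange lemma for vector spaces applies.\<close>

lemma independent_card_le_generating:
  fixes B C :: "('v \<Rightarrow> 'r::idom) set"
  assumes "finite C" "finite B" "\<not> module.dependent vec_scale B" "B \<subseteq> module.span vec_scale C"
  shows "card B \<le> card C"
proof -
  interpret K: vector_space "vec_scale :: 'r fract \<Rightarrow> ('v \<Rightarrow> 'r fract) \<Rightarrow> _"
    by (rule vector_space_vec_scale)
  have "card (fract_vec ` B) \<le> card (fract_vec ` C)"
    using assms fract_vec_in_span[OF assms(1)]
    by (intro conjunct2[OF K.independent_span_bound]) (auto simp: dependent_fract_vec_iff)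
  then show ?thesis
    by (simp add: card_image inj_on_subset[OF inj_fract_vec])
qed

text \<open>A dependent \<open>C\<close> would lose an element over the fraction field without
  losing any of its span, and the smaller set would still bound \<open>card B\<close> from
  above.\<close>

lemma generating_independent_if_card_le:
  fixes B C :: "('v \<Rightarrow> 'r::idom) set"
  assumes "finite C" "finite B" "\<not> module.dependent vec_scale B" "B \<subseteq> module.span vec_scale C"
    and le: "card C \<le> card B"
  shows "\<not> module.dependent vec_scale C"
proof
  interpret K: vector_space "vec_scale :: 'r fract \<Rightarrow> ('v \<Rightarrow> 'r fract) \<Rightarrow> _"
    by (rule vector_space_vec_scale)
  assume "module.dependent vec_scale C"
  then have "module.dependent vec_scale (fract_vec ` C)"
    using assms by (simp add: dependent_fract_vec_iff)
  then obtain c where c: "c \<in> fract_vec ` C" "c \<in> module.span vec_scale (fract_vec ` C - {c})"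
    by (auto simp: K.dependent_def)
  then have "module.span vec_scale (fract_vec ` C) = module.span vec_scale (fract_vec ` C - {c})"
    by (metis K.span_redundant insert_Diff)
  then have "card (fract_vec ` B) \<le> card (fract_vec ` C - {c})"
    using assms fract_vec_in_span[OF assms(1)]
    by (intro conjunct2[OF K.independent_span_bound]) (auto simp: dependent_fract_vec_iff)
  also have "\<dots> < card (fract_vec ` C)"
    using c assms by (intro card_Diff1_less) auto
  finally show False
    using le by (simp add: card_image inj_on_subset[OF inj_fract_vec])
qed

section \<open>Homogeneous components\<close>

text \<open>The degree-\<open>d\<close> part: the outer exponent \<open>j\<close> belongs to
  \<open>y\<close>, which leaves the exponent \<open>d - j\<close> for \<open>x\<close>.\<close>

definition hcomp :: "nat \<Rightarrow> 'k::field poly poly \<Rightarrow> 'k poly poly" where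
  "hcomp d p = (\<Sum>j\<le>d. monom (monom (coeff (coeff p j) (d - j)) (d - j)) j)"

lemma coeff_hcomp: "coeff (coeff (hcomp d p) j) i = (if i + j = d then coeff (coeff p j) i else 0)"
proof -
  have "coeff (coeff (hcomp d p) j) i
      = (\<Sum>j'\<le>d. if j' = j then (if d - j = i then coeff (coeff p j) (d - j) else 0) else 0)"
    by (simp add: hcomp_def coeff_sum if_distrib[of "\<lambda>x. coeff x _"] cong: if_cong)
  then show ?thesis by auto
qed

lemma bipoly_eqI: "(\<And>i j. coeff (coeff p j) i = coeff (coeff q j) i) \<Longrightarrow> p = q"
  by (simp add: poly_eq_iff)

lemma coeff_coeff_mult:
  "coeff (coeff (p * q) j) i
    = (\<Sum>j'\<le>j. \<Sum>i'\<le>i. coeff (coeff p j') i' * coeff (coeff q (j - j')) (i - i'))"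
  by (simp add: coeff_mult coeff_sum)

lemma hcomp_0 [simp]: "hcomp d 0 = 0"
  by (simp add: hcomp_def)

lemma hcomp_add: "hcomp d (p + q) = hcomp d p + hcomp d q"
  by (rule bipoly_eqI) (simp add: coeff_hcomp)

lemma hcomp_sum: "hcomp d (\<Sum>x\<in>A. f x) = (\<Sum>x\<in>A. hcomp d (f x))"
  by (induction A rule: infinite_finite_induct) (auto simp: hcomp_add)

lemma hcomp_homogeneous: "homogeneous_poly d p \<Longrightarrow> hcomp d p = p"
  by (rule bipoly_eqI) (auto simp: coeff_hcomp homogeneous_poly_def)

text \<open>Multiplication by a form of degree \<open>e\<close> shifts homogeneous components by
  \<open>e\<close>. This lets a combination of homogeneous vectors be cut down to a single
  degree.\<close>

lemma hcomp_mult_homogeneous: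
  assumes "homogeneous_poly e h"
  shows "hcomp d (r * h) = (if e \<le> d then hcomp (d - e) r * h else 0)"
proof (rule bipoly_eqI)
  fix i j
  have h: "coeff (coeff h b) a = 0" if "a + b \<noteq> e" for a b
    using assms that by (auto simp: homogeneous_poly_def)
  show "coeff (coeff (hcomp d (r * h)) j) i
      = coeff (coeff (if e \<le> d then hcomp (d - e) r * h else 0) j) i"
  proof (cases "e \<le> d")
    case True
    \<comment> \<open>Only terms whose second factor has total degree \<open>e\<close> survive; for
      these, \<open>i' + j' = d - e\<close> holds exactly when \<open>i + j = d\<close>.\<close>
    have "coeff (coeff (hcomp (d - e) r * h) j) i
      = (\<Sum>j'\<le>j. \<Sum>i'\<le>i. (if i + j = d then coeff (coeff r j') i' else 0)
            * coeff (coeff h (j - j')) (i - i'))"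
      unfolding coeff_coeff_mult coeff_hcomp using True
      by (intro sum.cong refl) (auto simp: h)
    also have "\<dots> = (if i + j = d then coeff (coeff (r * h) j) i else 0)"
      by (simp add: coeff_coeff_mult)
    finally show ?thesis using True by (simp add: coeff_hcomp)
  next
    case False
    then show ?thesis
      by (auto simp: coeff_hcomp coeff_coeff_mult intro!: sum.neutral h)
  qed
qed

lemma homogeneous_poly_0 [simp]: "homogeneous_poly d 0"
  by (simp add: homogeneous_poly_def)

lemma homogeneous_poly_add:
  "homogeneous_poly d p \<Longrightarrow> homogeneous_poly d q \<Longrightarrow> homogeneous_poly d (p + q)"
  unfolding homogeneous_poly_def by (metis add_0 coeff_add)

lemma homogeneous_poly_uminus: "homogeneous_poly d p \<Longrightarrow> homogeneous_poly d (- p)"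
  by (simp add: homogeneous_poly_def)

lemma homogeneous_poly_sum:
  "(\<And>x. x \<in> A \<Longrightarrow> homogeneous_poly d (f x)) \<Longrightarrow> homogeneous_poly d (\<Sum>x\<in>A. f x)"
  by (induction A rule: infinite_finite_induct) (auto simp: homogeneous_poly_add)

lemma homogeneous_poly_mult:
  assumes "homogeneous_poly d p" "homogeneous_poly e q"
  shows "homogeneous_poly (d + e) (p * q)"
proof -
  have "p * q = hcomp (d + e) (p * q)"
    using assms by (simp add: hcomp_mult_homogeneous hcomp_homogeneous)
  moreover have "homogeneous_poly k (hcomp k r)" for k r
    by (simp add: homogeneous_poly_def coeff_hcomp)
  ultimately show ?thesis by metis
qed

lemma homogeneous_poly_degree_unique:
  "homogeneous_poly d p \<Longrightarrow> homogeneous_poly e p \<Longrightarrow> p \<noteq> 0 \<Longrightarrow> d = e"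
  by (auto simp: homogeneous_poly_def poly_eq_iff)

lemma vec_degree_eqI:
  assumes "homogeneous_vec d b" "b \<noteq> 0"
  shows "vec_degree b = d"
proof -
  obtain v where "b v \<noteq> 0" using assms(2) by (auto simp: fun_eq_iff)
  then show ?thesis
    using assms(1) unfolding vec_degree_def homogeneous_vec_def
    by (intro the_equality) (blast dest: homogeneous_poly_degree_unique)+
qed

section \<open>Uniqueness of the degree sequence\<close>

text \<open>In the degree-\<open>e\<close> part of a combination representing \<open>m\<close>, generators of degree above \<open>e\<close>
  drop out.\<close>
lemma homogeneous_in_span_low_degree:
  fixes C :: "('v \<Rightarrow> 'k::field poly poly) set"
  assumes "finite C" "\<And>c. c \<in> C \<Longrightarrow> homogeneous_vec (\<delta> c) c"
    and m: "m \<in> module.span vec_scale C" "homogeneous_vec e m"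
  shows "m \<in> module.span vec_scale {c \<in> C. \<delta> c \<le> e}"
proof -
  obtain u where u: "m = (\<Sum>c\<in>C. vec_scale (u c) c)"
    using assms by (auto simp: vec.span_finite)
  have "m = (\<Sum>c\<in>C. if \<delta> c \<le> e then vec_scale (hcomp (e - \<delta> c) (u c)) c else 0)"
  proof
    fix v
    have "m v = hcomp e (m v)"
      using m by (simp add: homogeneous_vec_def hcomp_homogeneous)
    also have "\<dots> = (\<Sum>c\<in>C. if \<delta> c \<le> e then hcomp (e - \<delta> c) (u c) * c v else 0)"
      unfolding u sum_fun_apply hcomp_sum vec_scale_apply
      using assms(2) by (intro sum.cong refl hcomp_mult_homogeneous) (auto simp: homogeneous_vec_def)
    finally show "m v = (\<Sum>c\<in>C. if \<delta> c \<le> e then vec_scale (hcomp (e - \<delta> c) (u c)) c else 0) v"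
      by (auto simp: sum_fun_apply intro!: sum.cong)
  qed
  also have "\<dots> \<in> module.span vec_scale {c \<in> C. \<delta> c \<le> e}"
    by (intro vec.span_sum) (auto intro: vec.span_scale vec.span_base vec.span_zero)
  finally show ?thesis .
qed

lemma independent_homogeneous_vec_degree:
  assumes "\<not> module.dependent vec_scale B" "homogeneous_set B" "b \<in> B"
  shows "homogeneous_vec (vec_degree b) b"
proof -
  have "b \<noteq> 0" using assms vec.dependent_zero by blast
  moreover obtain d where "homogeneous_vec d b" using assms by (auto simp: homogeneous_set_def)
  ultimately show ?thesis by (simp add: vec_degree_eqI)
qed

text \<open>Each element of \<open>B\<close> of degree at most \<open>d\<close> only involves
  elements of \<open>C\<close> of no larger degree, so the rank bound applies to the two truncated
  sets.\<close>

lemma card_low_degree_le: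
  fixes B C :: "('v \<Rightarrow> 'k::field poly poly) set"
  assumes B: "finite B" "\<not> module.dependent vec_scale B" "homogeneous_set B"
    and C: "finite C" "\<not> module.dependent vec_scale C" "homogeneous_set C"
    and "B \<subseteq> module.span vec_scale C"
  shows "card {b \<in> B. vec_degree b \<le> d} \<le> card {c \<in> C. vec_degree c \<le> d}"
proof (rule independent_card_le_generating)
  show "\<not> module.dependent vec_scale {b \<in> B. vec_degree b \<le> d}"
    by (rule vec.independent_mono[OF B(2)]) auto
  show "{b \<in> B. vec_degree b \<le> d} \<subseteq> module.span vec_scale {c \<in> C. vec_degree c \<le> d}"
  proof
    fix b assume b: "b \<in> {b \<in> B. vec_degree b \<le> d}"
    then have "b \<in> module.span vec_scale {c \<in> C. vec_degree c \<le> vec_degree b}"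
      using assms by (intro homogeneous_in_span_low_degree independent_homogeneous_vec_degree) auto
    also have "\<dots> \<subseteq> module.span vec_scale {c \<in> C. vec_degree c \<le> d}"
      using b by (intro vec.span_mono) auto
    finally show "b \<in> module.span vec_scale {c \<in> C. vec_degree c \<le> d}" .
  qed
qed (use B C in auto)

text \<open>The rank argument compares cumulative counts; this recovers the exact ones. Degree 0 is
  split off because the truncated \<open>0 - 1\<close> would subtract its count from itself.\<close>

lemma card_fibre_eq_diff:
  fixes f :: "'a \<Rightarrow> nat"
  assumes "finite B"
  shows "card {b \<in> B. f b = d} = card {b \<in> B. f b \<le> d} - (if d = 0 then 0 else card {b \<in> B. f b \<le> d - 1})"
proof (cases d)
  case (Suc e)
  have "{b \<in> B. f b = Suc e} = {b \<in> B. f b \<le> Suc e} - {b \<in> B. f b \<le> e}" by auto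
  moreover have "card ({b \<in> B. f b \<le> Suc e} - {b \<in> B. f b \<le> e})
      = card {b \<in> B. f b \<le> Suc e} - card {b \<in> B. f b \<le> e}"
    using assms by (intro card_Diff_subset) auto
  ultimately show ?thesis using Suc by simp
qed simp

text \<open>The basis is minimum by the rank bound. Any competing minimum set \<open>C\<close> is no
  larger than \<open>B\<close>, hence independent, and comparing cumulative degree counts in both
  directions gives equality.\<close>

lemma has_degree_sequence_if_homogeneous_basis:
  fixes B :: "('v \<Rightarrow> 'k::field poly poly) set"
  assumes basis: "module_basis (splines V E \<alpha>) B" and B: "homogeneous_set B" "finite B"
  shows "has_degree_sequence V E \<alpha> (degree_list B)"
  unfolding has_degree_sequence_def
proof (intro conjI allI impI)
  have indep: "\<not> module.dependent vec_scale B" and span: "module.span vec_scale B = splines V E \<alpha>"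
    using basis by (auto simp: module_basis_def generating_set_def)
  have sub: "B \<subseteq> module.span vec_scale C" if "generating_set (splines V E \<alpha>) C" for C
    using that span vec.span_superset by (force simp: generating_set_def)
  have "minimum_generating_set (splines V E \<alpha>) B"
    unfolding minimum_generating_set_def
    using B(2) span sub indep by (auto simp: generating_set_def intro!: independent_card_le_generating)
  then show "\<exists>B. minimum_generating_set (splines V E \<alpha>) B \<and> homogeneous_set B"
    using B by blast
  fix C assume "minimum_generating_set (splines V E \<alpha>) C \<and> homogeneous_set C"
  then have C: "finite C" "module.span vec_scale C = splines V E \<alpha>" "homogeneous_set C"
    "card C \<le> card B"
    using B span by (auto simp: minimum_generating_set_def generating_set_def)
  have subs: "B \<subseteq> module.span vec_scale C" "C \<subseteq> module.span vec_scale B"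
    using C(2) span vec.span_superset by blast+
  have indC: "\<not> module.dependent vec_scale C"
    by (rule generating_independent_if_card_le[OF C(1) B(2) indep subs(1) C(4)])
  have le: "card {b \<in> B. vec_degree b \<le> d} = card {c \<in> C. vec_degree c \<le> d}" for d
    by (intro antisym card_low_degree_le[OF B(2) indep B(1) C(1) indC C(3) subs(1)]
        card_low_degree_le[OF C(1) indC C(3) B(2) indep B(1) subs(2)])
  have eq: "card {b \<in> B. vec_degree b = d} = card {c \<in> C. vec_degree c = d}" for d
    unfolding card_fibre_eq_diff[OF B(2)] card_fibre_eq_diff[OF C(1)] le ..
  \<comment> \<open>The occurring degrees are determined by the counts, so both maxima agree and the
    two lists have the same length.\<close>
  have "vec_degree ` B = {d. card {b \<in> B. vec_degree b = d} \<noteq> 0}"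
    using B(2) by (auto simp: card_eq_0_iff)
  also have "\<dots> = vec_degree ` C"
    unfolding eq using C(1) by (auto simp: card_eq_0_iff)
  finally show "degree_list C = degree_list B"
    by (simp add: degree_list_def eq)
qed

text \<open>Works with indices instead of a set of vectors, so that coefficients can be given per
  index. Injectivity comes for free: a repeated vector would give a relation with coefficients 1 and
  -1.\<close>

lemma module_basis_family:
  fixes b :: "'i \<Rightarrow> 'v \<Rightarrow> 'r::comm_ring_1"
  assumes "finite I"
    and mem: "\<And>r. (\<Sum>i\<in>I. vec_scale (r i) (b i)) \<in> M"
    and gen: "\<And>m. m \<in> M \<Longrightarrow> \<exists>r. m = (\<Sum>i\<in>I. vec_scale (r i) (b i))"
    and indep: "\<And>r i. (\<Sum>i\<in>I. vec_scale (r i) (b i)) = 0 \<Longrightarrow> i \<in> I \<Longrightarrow> r i = 0"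
  shows "module_basis M (b ` I)" "inj_on b I"
proof -
  show inj: "inj_on b I"
  proof (rule inj_onI, rule ccontr)
    fix i j assume ij: "i \<in> I" "j \<in> I" "b i = b j" "i \<noteq> j"
    have eq: "vec_scale (of_bool (k = i) - of_bool (k = j)) (b k)
        = (if k = i then b i else 0) - (if k = j then b i else 0)" for k
      using ij by (auto simp: fun_eq_iff)
    have "(\<Sum>k\<in>I. vec_scale (of_bool (k = i) - of_bool (k = j)) (b k)) = 0"
      unfolding eq using ij \<open>finite I\<close> by (simp add: sum_subtractf)
    from indep[OF this ij(1)] show False using ij by simp
  qed
  have "module.span vec_scale (b ` I) = M"
  proof (rule set_eqI)
    fix m
    have "m \<in> module.span vec_scale (b ` I) \<longleftrightarrow> (\<exists>u. m = (\<Sum>i\<in>I. vec_scale (u (b i)) (b i)))"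
      using inj \<open>finite I\<close> by (auto simp: vec.span_finite sum.reindex)
    also have "\<dots> \<longleftrightarrow> m \<in> M"
    proof
      assume "m \<in> M"
      then obtain r where r: "m = (\<Sum>i\<in>I. vec_scale (r i) (b i))" using gen by blast
      then have "m = (\<Sum>i\<in>I. vec_scale (r (the_inv_into I b (b i))) (b i))"
        using inj by (simp add: the_inv_into_f_f cong: sum.cong)
      then show "\<exists>u. m = (\<Sum>i\<in>I. vec_scale (u (b i)) (b i))"
        by (rule exI[where x = "\<lambda>x. r (the_inv_into I b x)"])
    qed (use mem in auto)
    finally show "m \<in> module.span vec_scale (b ` I) \<longleftrightarrow> m \<in> M" .
  qed
  moreover have "\<not> module.dependent vec_scale (b ` I)"
  proof
    assume "module.dependent vec_scale (b ` I)"
    then obtain u where u: "\<exists>i\<in>I. u (b i) \<noteq> 0" "(\<Sum>i\<in>I. vec_scale (u (b i)) (b i)) = 0"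
      using inj \<open>finite I\<close> by (auto simp: vec.dependent_finite sum.reindex)
    then show False using indep[OF u(2)] by blast
  qed
  ultimately show "module_basis M (b ` I)"
    by (simp add: module_basis_def generating_set_def)
qed

lemma degree_list_family:
  assumes "inj_on b I" "\<And>i. i \<in> I \<Longrightarrow> vec_degree (b i) = \<delta> i"
  shows "degree_list (b ` I) = map (\<lambda>j. card {i \<in> I. \<delta> i = j}) [0..<Suc (Max (\<delta> ` I))]"
proof -
  have "{x \<in> b ` I. vec_degree x = j} = b ` {i \<in> I. \<delta> i = j}" for j
    using assms by auto
  moreover have "card (b ` {i \<in> I. \<delta> i = j}) = card {i \<in> I. \<delta> i = j}" for j
    using assms by (intro card_image) (auto intro: inj_on_subset)
  moreover have "vec_degree ` b ` I = \<delta> ` I"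
    using assms by (auto simp: image_image)
  ultimately show ?thesis by (simp add: degree_list_def)
qed

section \<open>Squares of linear forms\<close>

definition lin_form :: "'k::field \<Rightarrow> 'k poly poly" where
  "lin_form a = var_x + scalar a * var_y"

lemma scalar_0 [simp]: "scalar 0 = 0"
  and scalar_1 [simp]: "scalar 1 = 1"
  and scalar_add: "scalar (a + b) = scalar a + scalar b"
  and scalar_diff: "scalar (a - b) = scalar a - scalar b"
  and scalar_mult: "scalar (a * b) = scalar a * scalar b"
  by (simp_all add: scalar_def one_pCons)

lemma scalar_power: "scalar (a ^ m) = scalar a ^ m"
  by (induction m) (simp_all add: scalar_mult)

lemma scalar_inverse_mult: "a \<noteq> 0 \<Longrightarrow> scalar (inverse a) * scalar a = 1"
  by (simp flip: scalar_mult)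

lemma scalar_eq_0_iff [simp]: "scalar a = 0 \<longleftrightarrow> a = 0"
  by (simp add: scalar_def)

lemma lin_form_eq_pCons: "lin_form a = [:[:0, 1:], [:a:]:]"
  by (simp add: lin_form_def var_x_def var_y_def scalar_def)

lemma lin_form_nonzero [simp]: "lin_form a \<noteq> 0"
  by (simp add: lin_form_eq_pCons)

lemma homogeneous_scalar: "homogeneous_poly 0 (scalar a)"
  by (auto simp: homogeneous_poly_def scalar_def coeff_pCons split: nat.splits)

lemma homogeneous_lin_form: "homogeneous_poly 1 (lin_form a)"
  by (auto simp: homogeneous_poly_def lin_form_eq_pCons coeff_pCons split: nat.splits)

lemma homogeneous_lin_form_square: "homogeneous_poly 2 (lin_form a ^ 2)"
  using homogeneous_poly_mult[OF homogeneous_lin_form homogeneous_lin_form, of a a]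
  by (simp add: power2_eq_square numeral_2_eq_2)

lemma homogeneous_scalar_mult: "homogeneous_poly d p \<Longrightarrow> homogeneous_poly d (scalar a * p)"
  using homogeneous_poly_mult[OF homogeneous_scalar] by fastforce

lemma lin_form_square_expand:
  "lin_form a ^ 2 = var_x ^ 2 + scalar a * (2 * var_x * var_y) + scalar (a ^ 2) * var_y ^ 2"
  unfolding lin_form_def scalar_power by algebra

text \<open>Modulo \<open>lin_form a\<close> the form \<open>lin_form b\<close> is a nonzero multiple of \<open>y\<close>, and comparing
  coefficients of \<open>y^0\<close> shows that \<open>y\<close> is not a zero divisor there.\<close>
lemma lin_form_dvd_if_dvd_mult:
  assumes "a \<noteq> b" and eq: "lin_form b * g = lin_form a * f"
  shows "lin_form a dvd g"
proof -
  define h where "h = scalar (inverse (b - a)) * (f - g)"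
  have "scalar (b - a) * (var_y * g) = lin_form a * (f - g)"
    using eq unfolding lin_form_def scalar_diff by algebra
  then have "scalar (inverse (b - a)) * scalar (b - a) * (var_y * g) = lin_form a * h"
    unfolding h_def by (simp add: mult_ac)
  then have h: "var_y * g = lin_form a * h"
    using assms(1) by (simp add: scalar_inverse_mult)
  have "poly (var_y * g) 0 = 0" by (simp add: var_y_def)
  then have "poly h 0 = 0" by (simp add: h lin_form_eq_pCons)
  then obtain h' where "h = var_y * h'"
    by (auto simp: poly_eq_0_iff_dvd var_y_def)
  then have "var_y * g = var_y * (lin_form a * h')"
    using h by (simp add: mult_ac)
  then show ?thesis by (simp add: var_y_def)
qed

text \<open>The squares of two non-proportional linear forms are coprime, so their only syzygies are
  multiples of the Koszul one. The factor \<open>lin_form a\<close> is split off \<open>g\<close>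
  twice, and \<open>f\<close> then follows by cancellation.\<close>

lemma lin_form_square_syzygy:
  assumes "a \<noteq> b" and eq: "lin_form b ^ 2 * g = lin_form a ^ 2 * f"
  shows "\<exists>r. g = lin_form a ^ 2 * r \<and> f = lin_form b ^ 2 * r"
proof -
  have square: "lin_form a dvd h" if "lin_form b ^ 2 * h = lin_form a * k" for h k
  proof -
    have "lin_form b * (lin_form b * h) = lin_form a * k"
      using that by (simp add: power2_eq_square mult_ac)
    then have "lin_form a dvd lin_form b * h"
      by (rule lin_form_dvd_if_dvd_mult[OF assms(1)])
    then show ?thesis using lin_form_dvd_if_dvd_mult[OF assms(1)] by (metis dvdE)
  qed
  have "lin_form b ^ 2 * g = lin_form a * (lin_form a * f)"
    using eq by (simp add: power2_eq_square mult_ac)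
  then obtain g' where g': "g = lin_form a * g'" using square by blast
  then have "lin_form a * (lin_form b ^ 2 * g') = lin_form a * (lin_form a * f)"
    using eq by (simp add: power2_eq_square mult_ac)
  then have "lin_form b ^ 2 * g' = lin_form a * f" by simp
  then obtain r where r: "g' = lin_form a * r" using square by blast
  then have g: "g = lin_form a ^ 2 * r" using g' by (simp add: power2_eq_square mult_ac)
  then have "lin_form a ^ 2 * (lin_form b ^ 2 * r) = lin_form a ^ 2 * f"
    using eq by (simp add: mult_ac)
  then show ?thesis using g by simp
qed

text \<open>In terms of \<open>x^2\<close>, \<open>2xy\<close>, \<open>y^2\<close> the square has
  coordinates \<open>1\<close>, \<open>d\<close>, \<open>d^2\<close>. So the weights are those of
  Lagrange interpolation at the nodes \<open>a\<close>, \<open>b\<close>, \<open>c\<close>, which is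
  exact up to degree 2.\<close>

lemma lin_form_square_interpolation:
  fixes a b c d :: "'k::field"
  assumes "a \<noteq> b" "b \<noteq> c" "a \<noteq> c"
  shows "\<exists>l1 l2 l3. lin_form d ^ 2
    = scalar l1 * lin_form a ^ 2 + scalar l2 * lin_form b ^ 2 + scalar l3 * lin_form c ^ 2"
proof -
  define D where "D = (a - b) * (b - c) * (c - a)"
  have "D \<noteq> 0" using assms by (simp add: D_def)
  define l1 l2 l3 where
    "l1 = - (d - b) * (d - c) * (b - c) / D" and
    "l2 = - (d - a) * (d - c) * (c - a) / D" and
    "l3 = - (d - a) * (d - b) * (a - b) / D"
  \<comment> \<open>Multiplying by the Vandermonde factor \<open>D\<close> removes the divisions and
    leaves polynomial identities.\<close>
  have "D * l1 = - (d - b) * (d - c) * (b - c)" "D * l2 = - (d - a) * (d - c) * (c - a)"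
    "D * l3 = - (d - a) * (d - b) * (a - b)"
    using \<open>D \<noteq> 0\<close> by (simp_all add: l1_def l2_def l3_def)
  then have "D * (l1 + l2 + l3) = D * 1" "D * (l1 * a + l2 * b + l3 * c) = D * d"
    "D * (l1 * a ^ 2 + l2 * b ^ 2 + l3 * c ^ 2) = D * d ^ 2"
    unfolding D_def by algebra+
  then have l: "l1 + l2 + l3 = 1" "l1 * a + l2 * b + l3 * c = d"
    "l1 * a ^ 2 + l2 * b ^ 2 + l3 * c ^ 2 = d ^ 2"
    using \<open>D \<noteq> 0\<close> by auto
  have "scalar l1 * lin_form a ^ 2 + scalar l2 * lin_form b ^ 2 + scalar l3 * lin_form c ^ 2
    = scalar (l1 + l2 + l3) * var_x ^ 2 + scalar (l1 * a + l2 * b + l3 * c) * (2 * var_x * var_y)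
      + scalar (l1 * a ^ 2 + l2 * b ^ 2 + l3 * c ^ 2) * var_y ^ 2"
    unfolding lin_form_square_expand scalar_add scalar_mult by (simp add: algebra_simps)
  also have "\<dots> = lin_form d ^ 2"
    unfolding l by (simp add: lin_form_square_expand)
  finally show ?thesis by metis
qed

lemma hcomp_0_eq_scalar: "hcomp 0 f = scalar (coeff (coeff f 0) 0)"
  by (rule bipoly_eqI) (auto simp: coeff_hcomp scalar_def coeff_pCons split: nat.splits)

text \<open>A polynomial without constant term lies in the ideal generated by \<open>x\<close> and
  \<open>y\<close>, and both variables are scalar combinations of two distinct forms
  \<open>lin_form a\<close>, \<open>lin_form b\<close>.\<close>

lemma linear_combination_if_constant_coeff_0:
  assumes "a \<noteq> b" "coeff (coeff f 0) 0 = 0"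
  shows "\<exists>r s. f = r * lin_form a + s * lin_form b"
proof -
  obtain g h where f: "f = pCons g h" by (cases f)
  obtain k where g: "g = pCons 0 k" using assms(2) f by (cases g) auto
  have f': "f = var_x * [:k:] + var_y * h"
    by (simp add: f g var_x_def var_y_def)
  define i where "i = scalar (inverse (b - a))"
  have i: "i * (scalar b - scalar a) = 1"
    using assms(1) scalar_inverse_mult[of "b - a"] by (simp add: i_def scalar_diff)
  have "var_x = i * (scalar b * lin_form a - scalar a * lin_form b)"
    "var_y = i * (lin_form b - lin_form a)"
    using i unfolding lin_form_def by algebra+
  then have "f = (i * scalar b * [:k:] - i * h) * lin_form a
      + (i * h - i * scalar a * [:k:]) * lin_form b"
    unfolding f' by algebra
  then show ?thesis by blast
qed

text \<open>In degree 2 a syzygy is a linear relation between the three squares, which are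
  linearly independent as \<open>2 \<noteq> 0\<close>.\<close>
lemma syzygy_constant_coeff_0:
  fixes a b c :: "'k::field"
  assumes "a \<noteq> c" "b \<noteq> c" "(2::'k) \<noteq> 0"
    and eq: "lin_form a ^ 2 * f1 + lin_form b ^ 2 * f2 + lin_form c ^ 2 * f3 = 0"
  shows "coeff (coeff f3 0) 0 = 0"
proof -
  define z where "z f = coeff (coeff f 0) 0" for f :: "'k poly poly"
  have "hcomp 2 (f1 * lin_form a ^ 2 + f2 * lin_form b ^ 2 + f3 * lin_form c ^ 2) = 0"
    using eq by (simp add: mult.commute)
  then have z: "scalar (z f1) * lin_form a ^ 2 + scalar (z f2) * lin_form b ^ 2
      + scalar (z f3) * lin_form c ^ 2 = 0"
    by (simp add: hcomp_add hcomp_mult_homogeneous[OF homogeneous_lin_form_square]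
        hcomp_0_eq_scalar z_def)
  have coeffs: "coeff (coeff (scalar s * lin_form d ^ 2) 0) 2 = s"
    "coeff (coeff (scalar s * lin_form d ^ 2) 1) 1 = 2 * (s * d)"
    "coeff (coeff (scalar s * lin_form d ^ 2) 2) 0 = s * d ^ 2" for s d :: 'k
    by (simp_all add: lin_form_eq_pCons scalar_def power2_eq_square numeral_2_eq_2)
  have "z f1 + z f2 + z f3 = 0"
    using arg_cong[OF z, of "\<lambda>p. coeff (coeff p 0) 2"] by (simp add: coeffs)
  moreover have "2 * (z f1 * a + z f2 * b + z f3 * c) = 0"
    using arg_cong[OF z, of "\<lambda>p. coeff (coeff p 1) 1"] by (simp only: coeff_add coeffs distrib_left) simp
  then have "z f1 * a + z f2 * b + z f3 * c = 0"
    using assms(3) by (simp only: mult_eq_0_iff) simp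
  moreover have "z f1 * a ^ 2 + z f2 * b ^ 2 + z f3 * c ^ 2 = 0"
    using arg_cong[OF z, of "\<lambda>p. coeff (coeff p 2) 0"] by (simp add: coeffs)
  \<comment> \<open>The three relations are the moments of orders 0, 1, 2 of the weights at
    \<open>a\<close>, \<open>b\<close>, \<open>c\<close>. Pairing them with the polynomial
    \<open>(X - a) * (X - b)\<close> isolates the third weight.\<close>
  ultimately have "z f3 * ((c - a) * (c - b)) = 0" by algebra
  then show ?thesis using assms by (simp add: z_def)
qed

context
  fixes a b c s t :: "'k::field"
  assumes distinct: "a \<noteq> b" "a \<noteq> c" "b \<noteq> c" and two: "(2::'k) \<noteq> 0"
    and st: "s + t = 1" "s * a + t * b = c"
begin

text \<open>All three forms have \<open>x\<close>-coefficient 1, so \<open>s + t = 1\<close> matches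
  the \<open>x\<close>-parts and the other equation on \<open>s\<close> and \<open>t\<close> matches
  the \<open>y\<close>-parts.\<close>

lemma lin_form_affine: "lin_form c = scalar s * lin_form a + scalar t * lin_form b"
proof -
  have "scalar s + scalar t = 1" "scalar s * scalar a + scalar t * scalar b = scalar c"
    using st by (simp_all flip: scalar_add scalar_mult)
  then show ?thesis unfolding lin_form_def by algebra
qed

lemma affine_coeffs_nonzero: "s \<noteq> 0" "t \<noteq> 0" "scalar s \<noteq> 0" "scalar t \<noteq> 0"
  using st distinct by auto

text \<open>The linear syzygies express \<open>v * u^2 = u * (u v)\<close> and \<open>u * v^2 = v * (u v)\<close> for
  \<open>u = lin_form a\<close>, \<open>v = lin_form b\<close>, with \<open>u v\<close> solved for from \<open>(s u + t v)^2\<close>.\<close>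

lemma linear_syzygies:
  "lin_form a ^ 2 * (scalar (2 * s * t) * lin_form b + scalar (s ^ 2) * lin_form a)
    + lin_form b ^ 2 * (scalar (t ^ 2) * lin_form a) + lin_form c ^ 2 * (- lin_form a) = 0"
  "lin_form a ^ 2 * (scalar (s ^ 2) * lin_form b)
    + lin_form b ^ 2 * (scalar (2 * s * t) * lin_form a + scalar (t ^ 2) * lin_form b)
    + lin_form c ^ 2 * (- lin_form b) = 0"
  unfolding lin_form_affine mult_2 scalar_power scalar_mult scalar_add by algebra+

text \<open>As \<open>f3\<close> has no constant term, a combination of the two linear syzygies
  cancels the third coordinate. What is left is a multiple of the Koszul syzygy of the first two
  squares, and \<open>lin_form b\<close> times the first linear syzygy minus
  \<open>lin_form a\<close> times the second is \<open>2 * s * t\<close> times that one.\<close>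

lemma linear_syzygies_span:
  assumes eq: "lin_form a ^ 2 * f1 + lin_form b ^ 2 * f2 + lin_form c ^ 2 * f3 = 0"
  shows "\<exists>r1 r2. f1 = r1 * (scalar (2 * s * t) * lin_form b + scalar (s ^ 2) * lin_form a)
        + r2 * (scalar (s ^ 2) * lin_form b) \<and>
      f2 = r1 * (scalar (t ^ 2) * lin_form a)
        + r2 * (scalar (2 * s * t) * lin_form a + scalar (t ^ 2) * lin_form b) \<and>
      f3 = r1 * (- lin_form a) + r2 * (- lin_form b)"
proof -
  obtain p1 p2 where f3: "f3 = p1 * lin_form a + p2 * lin_form b"
    using linear_combination_if_constant_coeff_0 syzygy_constant_coeff_0 eq distinct two by meson
  define k11 k12 k21 k22 where
    "k11 = scalar (2 * s * t) * lin_form b + scalar (s ^ 2) * lin_form a" and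
    "k12 = scalar (t ^ 2) * lin_form a" and
    "k21 = scalar (s ^ 2) * lin_form b" and
    "k22 = scalar (2 * s * t) * lin_form a + scalar (t ^ 2) * lin_form b"
  have "lin_form a ^ 2 * (f1 + p1 * k11 + p2 * k21) = lin_form b ^ 2 * - (f2 + p1 * k12 + p2 * k22)"
    using linear_syzygies eq unfolding f3 k11_def[symmetric] k12_def[symmetric]
      k21_def[symmetric] k22_def[symmetric] by algebra
  then obtain r where r: "f1 + p1 * k11 + p2 * k21 = lin_form b ^ 2 * r"
    "- (f2 + p1 * k12 + p2 * k22) = lin_form a ^ 2 * r"
    using lin_form_square_syzygy distinct(1) by metis
  \<comment> \<open>Invertibility of \<open>2 * s * t\<close> is where the characteristic
    enters.\<close>
  define i where "i = scalar (inverse (2 * s * t))"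
  have i: "i * scalar (2 * s * t) = 1"
    using affine_coeffs_nonzero two unfolding i_def by (intro scalar_inverse_mult) simp
  define r1 r2 where "r1 = i * r * lin_form b - p1" and "r2 = - i * r * lin_form a - p2"
  have "f1 = r1 * k11 + r2 * k21"
    using r(1) i unfolding k11_def k21_def r1_def r2_def by algebra
  moreover have "f2 = r1 * k12 + r2 * k22"
    using r(2) i unfolding k12_def k22_def r1_def r2_def by algebra
  moreover have "f3 = r1 * (- lin_form a) + r2 * (- lin_form b)"
    unfolding f3 r1_def r2_def by algebra
  ultimately show ?thesis
    unfolding k11_def k12_def k21_def k22_def by blast
qed

text \<open>Adding \<open>s^2\<close> times the second relation to the first leaves only a nonzero
  multiple of \<open>lin_form b * r1\<close>.\<close>

lemma linear_syzygies_independent: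
  assumes "r1 * (scalar (2 * s * t) * lin_form b + scalar (s ^ 2) * lin_form a)
        + r2 * (scalar (s ^ 2) * lin_form b) = 0"
    and "r1 * (- lin_form a) + r2 * (- lin_form b) = 0"
  shows "r1 = 0" "r2 = 0"
proof -
  have "scalar (2 * s * t) * (lin_form b * r1) = 0" using assms by algebra
  then show "r1 = 0"
    using affine_coeffs_nonzero two by simp
  with assms(2) show "r2 = 0" by simp
qed

end

section \<open>Splines on a cycle\<close>

lemma span_singleton_eq_dvd:
  "p \<in> module.span (*) {q} \<longleftrightarrow> q dvd p" for q :: "'r::comm_ring_1"
proof -
  interpret module "(*) :: 'r \<Rightarrow> 'r \<Rightarrow> 'r"
    by unfold_locales (auto simp: algebra_simps)
  show ?thesis by (auto simp: span_singleton dvd_def mult.commute)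
qed

text \<open>Edge \<open>i\<close> joins \<open>c i\<close> to \<open>c (Suc i mod n)\<close> and
  carries the principal ideal of \<open>q i\<close>. Nonzero labels in a domain make the multipliers
  of the jumps unique.\<close>

locale cycle_labels =
  fixes n :: nat and c :: "nat \<Rightarrow> 'v" and q :: "nat \<Rightarrow> 'r::idom"
  assumes n: "n > 0" and inj: "inj_on c {..<n}" and q_nonzero: "\<And>i. i < n \<Longrightarrow> q i \<noteq> 0"
begin

definition spline_module :: "('v \<Rightarrow> 'r) set" where
  "spline_module = {p. (\<forall>v. v \<notin> c ` {..<n} \<longrightarrow> p v = 0) \<and>
     (\<forall>i<n. q i dvd p (c (Suc i mod n)) - p (c i))}"

definition syzygy :: "(nat \<Rightarrow> 'r) \<Rightarrow> bool" where
  "syzygy h \<longleftrightarrow> (\<Sum>j<n. q j * h j) = 0"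

definition const_vec :: "'v \<Rightarrow> 'r" where
  "const_vec v = of_bool (v \<in> c ` {..<n})"

text \<open>The spline that starts at 0 in \<open>c 0\<close> and jumps by \<open>q j * h j\<close>
  along edge \<open>j\<close>. The inverse of \<open>c\<close> turns a vertex into its position on
  the cycle.\<close>

definition partial_sums :: "(nat \<Rightarrow> 'r) \<Rightarrow> 'v \<Rightarrow> 'r" where
  "partial_sums h v =
     (if v \<in> c ` {..<n} then \<Sum>j<the_inv_into {..<n} c v. q j * h j else 0)"

lemma partial_sums_apply: "i < n \<Longrightarrow> partial_sums h (c i) = (\<Sum>j<i. q j * h j)"
  by (simp add: partial_sums_def the_inv_into_f_f inj)

lemma partial_sums_outside: "v \<notin> c ` {..<n} \<Longrightarrow> partial_sums h v = 0"
  by (simp add: partial_sums_def)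

lemma const_vec_apply: "i < n \<Longrightarrow> const_vec (c i) = 1"
  by (simp add: const_vec_def)

lemma partial_sums_cong: "(\<And>j. j < n \<Longrightarrow> h j = h' j) \<Longrightarrow> partial_sums h = partial_sums h'"
proof (rule ext)
  fix v assume h: "\<And>j. j < n \<Longrightarrow> h j = h' j"
  show "partial_sums h v = partial_sums h' v"
  proof (cases "v \<in> c ` {..<n}")
    case True
    then obtain i where "i < n" "v = c i" by auto
    then show ?thesis using h by (auto simp: partial_sums_apply intro!: sum.cong)
  qed (simp add: partial_sums_outside)
qed

lemma partial_sums_lincomb:
  "(\<Sum>i\<in>I. vec_scale (r i) (partial_sums (g i))) = partial_sums (\<lambda>j. \<Sum>i\<in>I. r i * g i j)"
proof
  fix v
  have "(\<Sum>i\<in>I. r i * (\<Sum>j<k. q j * g i j)) = (\<Sum>j<k. q j * (\<Sum>i\<in>I. r i * g i j))" for k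
    unfolding sum_distrib_left by (subst sum.swap) (simp add: mult_ac)
  then show "(\<Sum>i\<in>I. vec_scale (r i) (partial_sums (g i))) v
      = partial_sums (\<lambda>j. \<Sum>i\<in>I. r i * g i j) v"
    by (simp add: sum_fun_apply partial_sums_def)
qed

lemma syzygy_lincomb:
  assumes "\<And>i. i \<in> I \<Longrightarrow> syzygy (g i)"
  shows "syzygy (\<lambda>j. \<Sum>i\<in>I. r i * g i j)"
proof -
  have "(\<Sum>j<n. q j * (\<Sum>i\<in>I. r i * g i j)) = (\<Sum>i\<in>I. r i * (\<Sum>j<n. q j * g i j))"
    unfolding sum_distrib_left by (subst sum.swap) (simp add: mult_ac)
  then show ?thesis using assms by (simp add: syzygy_def)
qed

lemma partial_sums_step:
  assumes "syzygy h" "i < n"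
  shows "partial_sums h (c (Suc i mod n)) - partial_sums h (c i) = q i * h i"
\<comment> \<open>The last edge returns to \<open>c 0\<close>, where the sum is empty; there the
  jump is right because the total sum vanishes.\<close>
proof (cases "Suc i = n")
  case True
  then have "(\<Sum>j<i. q j * h j) + q i * h i = 0"
    using assms(1) unfolding syzygy_def by (metis sum.lessThan_Suc)
  then show ?thesis using True n assms
    by (simp add: partial_sums_apply add_eq_0_iff2)
next
  case False
  then show ?thesis using assms by (simp add: partial_sums_apply)
qed

lemma const_vec_plus_partial_sums_in_spline_module:
  "syzygy h \<Longrightarrow> vec_scale r const_vec + partial_sums h \<in> spline_module"
  using n by (auto simp: spline_module_def const_vec_def partial_sums_outside
      add_diff_add partial_sums_step)

lemma spline_module_decompose:
  assumes "p \<in> spline_module"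
  shows "\<exists>h. syzygy h \<and> p = vec_scale (p (c 0)) const_vec + partial_sums h"
proof -
  have "\<forall>i. \<exists>h. i < n \<longrightarrow> p (c (Suc i mod n)) - p (c i) = q i * h"
    using assms by (auto simp: spline_module_def dvd_def)
  then obtain h where h: "\<And>i. i < n \<Longrightarrow> p (c (Suc i mod n)) - p (c i) = q i * h i"
    by metis
  \<comment> \<open>The jumps telescope. The value \<open>i = n\<close> is included because there
    the right-hand side is 0, which is the syzygy condition.\<close>
  have sums: "(\<Sum>j<i. q j * h j) = p (c (i mod n)) - p (c 0)" if "i \<le> n" for i
    using that
  proof (induction i)
    case (Suc i)
    then show ?case using h[of i] by (simp add: algebra_simps)
  qed (use n in simp)
  have "syzygy h" using sums[of n] by (simp add: syzygy_def)
  moreover have "p = vec_scale (p (c 0)) const_vec + partial_sums h"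
  proof
    fix v
    show "p v = (vec_scale (p (c 0)) const_vec + partial_sums h) v"
    proof (cases "v \<in> c ` {..<n}")
      case True
      then obtain i where "i < n" "v = c i" by auto
      then show ?thesis using sums[of i] by (simp add: partial_sums_apply const_vec_def)
    next
      case False
      then show ?thesis using assms
        by (simp add: spline_module_def partial_sums_outside const_vec_def)
    qed
  qed
  ultimately show ?thesis by blast
qed

text \<open>The value at \<open>c 0\<close> is \<open>r\<close>, and the jump along edge
  \<open>j\<close> is \<open>q j * h j\<close> with \<open>q j\<close> nonzero.\<close>

lemma const_vec_plus_partial_sums_eq_0:
  assumes "syzygy h" "vec_scale r const_vec + partial_sums h = 0"
  shows "r = 0" "\<And>j. j < n \<Longrightarrow> h j = 0"
proof -
  have eq: "r * const_vec v + partial_sums h v = 0" for v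
    using fun_cong[OF assms(2), of v] by simp
  show r: "r = 0" using eq[of "c 0"] n by (simp add: const_vec_apply partial_sums_apply)
  fix j assume j: "j < n"
  have "q j * h j = 0"
    using partial_sums_step[OF assms(1) j] eq r by simp
  then show "h j = 0" using q_nonzero[OF j] by simp
qed

text \<open>A basis of the syzygies has \<open>n - 1\<close> elements. It is indexed by the
  positions other than \<open>i0\<close>, and \<open>i0\<close> itself is given to the constant
  spline, so the whole basis is indexed by \<open>{..<n}\<close>.\<close>

lemma spline_module_basis:
  assumes i0: "i0 < n"
    and syz: "\<And>i. i \<in> {..<n} - {i0} \<Longrightarrow> syzygy (g i)"
    and gen: "\<And>h. syzygy h \<Longrightarrow> \<exists>r. \<forall>j<n. h j = (\<Sum>i\<in>{..<n} - {i0}. r i * g i j)"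
    and indep: "\<And>r i. (\<And>j. j < n \<Longrightarrow> (\<Sum>i\<in>{..<n} - {i0}. r i * g i j) = 0) \<Longrightarrow>
        i \<in> {..<n} - {i0} \<Longrightarrow> r i = 0"
  defines "b \<equiv> \<lambda>i. if i = i0 then const_vec else partial_sums (g i)"
  shows "module_basis spline_module (b ` {..<n})" "inj_on b {..<n}"
proof -
  have split: "(\<Sum>i<n. vec_scale (r i) (b i)) = vec_scale (r i0) const_vec
      + partial_sums (\<lambda>j. \<Sum>i\<in>{..<n} - {i0}. r i * g i j)" for r
  proof -
    have "(\<Sum>i<n. vec_scale (r i) (b i))
        = vec_scale (r i0) (b i0) + (\<Sum>i\<in>{..<n} - {i0}. vec_scale (r i) (b i))"
      using i0 by (intro sum.remove) auto
    also have "(\<Sum>i\<in>{..<n} - {i0}. vec_scale (r i) (b i))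
        = (\<Sum>i\<in>{..<n} - {i0}. vec_scale (r i) (partial_sums (g i)))"
      by (intro sum.cong) (auto simp: b_def)
    finally show ?thesis unfolding partial_sums_lincomb by (simp only: b_def if_True refl)
  qed
  have lc: "syzygy (\<lambda>j. \<Sum>i\<in>{..<n} - {i0}. r i * g i j)" for r
    using syz by (rule syzygy_lincomb)
  have mem: "(\<Sum>i<n. vec_scale (r i) (b i)) \<in> spline_module" for r
    unfolding split by (rule const_vec_plus_partial_sums_in_spline_module[OF lc])
  have gen': "\<exists>r. p = (\<Sum>i<n. vec_scale (r i) (b i))" if p: "p \<in> spline_module" for p
  proof -
    obtain h where h: "syzygy h" "p = vec_scale (p (c 0)) const_vec + partial_sums h"
      using spline_module_decompose[OF p] by blast
    obtain r where r: "\<forall>j<n. h j = (\<Sum>i\<in>{..<n} - {i0}. r i * g i j)"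
      using gen[OF h(1)] by blast
    have "p = vec_scale (p (c 0)) const_vec + partial_sums h" by (rule h(2))
    also have "partial_sums h = partial_sums (\<lambda>j. \<Sum>i\<in>{..<n} - {i0}. r i * g i j)"
      by (rule partial_sums_cong) (use r in blast)
    \<comment> \<open>The sum avoids \<open>i0\<close>, so \<open>r\<close> may be overwritten there
      with the coefficient of the constant spline.\<close>
    also have "(\<lambda>j. \<Sum>i\<in>{..<n} - {i0}. r i * g i j)
        = (\<lambda>j. \<Sum>i\<in>{..<n} - {i0}. (r(i0 := p (c 0))) i * g i j)"
      by (intro ext sum.cong) auto
    also have "vec_scale (p (c 0)) const_vec + partial_sums \<dots>
        = (\<Sum>i<n. vec_scale ((r(i0 := p (c 0))) i) (b i))"
      unfolding split fun_upd_same ..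
    finally show ?thesis by blast
  qed
  have indep': "r i = 0" if "(\<Sum>i<n. vec_scale (r i) (b i)) = 0" "i \<in> {..<n}" for r i
  proof (cases "i = i0")
    case True
    then show ?thesis
      using const_vec_plus_partial_sums_eq_0(1)[OF lc] that(1) unfolding split by blast
  next
    case False
    then show ?thesis
      using const_vec_plus_partial_sums_eq_0(2)[OF lc] that unfolding split
      by (intro indep[of r i]) auto
  qed
  show "module_basis spline_module (b ` {..<n})" "inj_on b {..<n}"
    by (rule module_basis_family; (fact mem gen' indep' | simp))+
qed

text \<open>If the labels \<open>q t\<close> with \<open>t \<in> T\<close> generate all the others, then every \<open>i \<notin> T\<close> contributes
  the syzygy expressing \<open>q i\<close> through them, and only the syzygies supported on \<open>T\<close> remain.\<close>

definition extend_syzygies ::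
    "nat set \<Rightarrow> (nat \<Rightarrow> nat \<Rightarrow> 'r) \<Rightarrow> (nat \<Rightarrow> nat \<Rightarrow> 'r) \<Rightarrow> nat \<Rightarrow> nat \<Rightarrow> 'r" where
  "extend_syzygies T l k i j =
     (if i \<in> T then if j \<in> T then k i j else 0
      else if j \<in> T then - l i j else of_bool (j = i))"

text \<open>The family is block triangular with an identity block off \<open>T\<close>. The
  coefficients off \<open>T\<close> are therefore forced, and everything reduces to the syzygies
  \<open>k\<close> of the labels in \<open>T\<close>.\<close>

lemma extend_syzygies_basis:
  fixes l k :: "nat \<Rightarrow> nat \<Rightarrow> 'r"
  assumes T: "T \<subseteq> {..<n}" "i0 \<in> T"
    and l: "\<And>i. i \<in> {..<n} - T \<Longrightarrow> q i = (\<Sum>t\<in>T. q t * l i t)"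
    and k_syz: "\<And>s. s \<in> T - {i0} \<Longrightarrow> (\<Sum>t\<in>T. q t * k s t) = 0"
    and k_gen: "\<And>f. (\<Sum>t\<in>T. q t * f t) = 0 \<Longrightarrow>
        \<exists>r. \<forall>t\<in>T. f t = (\<Sum>s\<in>T - {i0}. r s * k s t)"
    and k_indep: "\<And>r s. (\<And>t. t \<in> T \<Longrightarrow> (\<Sum>s\<in>T - {i0}. r s * k s t) = 0) \<Longrightarrow>
        s \<in> T - {i0} \<Longrightarrow> r s = 0"
  defines "b \<equiv> \<lambda>i. if i = i0 then const_vec else partial_sums (extend_syzygies T l k i)"
  shows "module_basis spline_module (b ` {..<n})" "inj_on b {..<n}"
proof -
  let ?g = "extend_syzygies T l k"
  have fT: "finite T" using T finite_subset by blast
  have splitT: "(\<Sum>j<n. f j) = (\<Sum>j\<in>T. f j) + (\<Sum>j\<in>{..<n} - T. f j)" for f :: "nat \<Rightarrow> 'r"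
    using sum.subset_diff[OF T(1), of f] by (simp add: add.commute)
  have splitT0: "(\<Sum>i\<in>{..<n} - {i0}. f i) = (\<Sum>i\<in>T - {i0}. f i) + (\<Sum>i\<in>{..<n} - T. f i)"
    for f :: "nat \<Rightarrow> 'r"
  proof -
    have "{..<n} - {i0} - (T - {i0}) = {..<n} - T" using T by auto
    then show ?thesis
      using sum.subset_diff[of "T - {i0}" "{..<n} - {i0}" f] T by (auto simp: add.commute)
  qed
  have syz: "syzygy (?g i)" if i: "i \<in> {..<n} - {i0}" for i
  proof (cases "i \<in> T")
    case True
    then show ?thesis
      using k_syz[of i] i by (simp add: syzygy_def splitT extend_syzygies_def)
  next
    case False
    have "(\<Sum>j\<in>{..<n} - T. q j * ?g i j) = (\<Sum>j\<in>{..<n} - T. if j = i then q i else 0)"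
      using False by (intro sum.cong) (auto simp: extend_syzygies_def)
    then show ?thesis
      using l[of i] i False by (simp add: syzygy_def splitT extend_syzygies_def sum_negf)
  qed
  \<comment> \<open>At a coordinate \<open>j\<close> off \<open>T\<close> only the generator
    \<open>j\<close> is nonzero, so that coordinate reads off its coefficient.\<close>
  have comb: "(\<Sum>i\<in>{..<n} - {i0}. r i * ?g i j)
      = (if j \<in> T then (\<Sum>s\<in>T - {i0}. r s * k s j) - (\<Sum>i\<in>{..<n} - T. r i * l i j) else r j)"
    if j: "j < n" for r j
  proof (cases "j \<in> T")
    case True
    then show ?thesis by (simp add: splitT0 extend_syzygies_def sum_negf)
  next
    case False
    have "(\<Sum>i\<in>{..<n} - T. r i * ?g i j) = (\<Sum>i\<in>{..<n} - T. if i = j then r j else 0)"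
      using False by (intro sum.cong) (auto simp: extend_syzygies_def)
    then show ?thesis using False j by (simp add: splitT0 extend_syzygies_def)
  qed
  have gen: "\<exists>r. \<forall>j<n. h j = (\<Sum>i\<in>{..<n} - {i0}. r i * ?g i j)" if h: "syzygy h" for h
  proof -
    \<comment> \<open>The part of \<open>h\<close> on \<open>T\<close> after subtraction of the
      generators off \<open>T\<close>, whose entries on \<open>T\<close> are \<open>- l i t\<close>;
      hence the plus sign.\<close>
    define f where "f t = h t + (\<Sum>i\<in>{..<n} - T. h i * l i t)" for t
    have "(\<Sum>t\<in>T. q t * f t) = (\<Sum>t\<in>T. q t * h t) + (\<Sum>i\<in>{..<n} - T. \<Sum>t\<in>T. q t * (h i * l i t))"
      unfolding f_def distrib_left sum_distrib_left sum.distrib by (subst sum.swap) simp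
    also have "(\<Sum>i\<in>{..<n} - T. \<Sum>t\<in>T. q t * (h i * l i t)) = (\<Sum>i\<in>{..<n} - T. q i * h i)"
    proof (rule sum.cong)
      fix i assume "i \<in> {..<n} - T"
      then have "q i * h i = (\<Sum>t\<in>T. q t * l i t) * h i" by (simp only: l)
      also have "\<dots> = (\<Sum>t\<in>T. q t * (h i * l i t))"
        unfolding sum_distrib_right by (intro sum.cong refl) (simp add: mult_ac)
      finally show "(\<Sum>t\<in>T. q t * (h i * l i t)) = q i * h i" by (rule sym)
    qed simp
    also have "(\<Sum>t\<in>T. q t * h t) + \<dots> = 0"
      using h by (simp add: syzygy_def splitT)
    finally obtain r where r: "\<forall>t\<in>T. f t = (\<Sum>s\<in>T - {i0}. r s * k s t)"
      using k_gen by blast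
    define R where "R i = (if i \<in> T then r i else h i)" for i
    have "h j = (\<Sum>i\<in>{..<n} - {i0}. R i * ?g i j)" if "j < n" for j
    proof -
      have "(\<Sum>s\<in>T - {i0}. R s * k s j) = (\<Sum>s\<in>T - {i0}. r s * k s j)"
        "(\<Sum>i\<in>{..<n} - T. R i * l i j) = (\<Sum>i\<in>{..<n} - T. h i * l i j)"
        by (auto simp: R_def intro!: sum.cong)
      then show ?thesis using r comb[OF that, of R] by (auto simp: R_def f_def algebra_simps)
    qed
    then show ?thesis by blast
  qed
  have indep: "r i = 0"
    if r: "\<And>j. j < n \<Longrightarrow> (\<Sum>i\<in>{..<n} - {i0}. r i * ?g i j) = 0" and i: "i \<in> {..<n} - {i0}" for r i
  proof -
    have out: "r j = 0" if "j \<in> {..<n} - T" for j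
      using r[of j] comb[of j r] that by auto
    have "(\<Sum>s\<in>T - {i0}. r s * k s t) = 0" if "t \<in> T" for t
      using r[of t] comb[of t r] that T out by auto
    then show ?thesis using k_indep[of r i] out i by blast
  qed
  show "module_basis spline_module (b ` {..<n})" "inj_on b {..<n}"
    unfolding b_def
    by (rule spline_module_basis[where g = ?g]; (fact syz gen indep | use T in blast))+
qed

end

section \<open>Homogeneous bases for cycles labelled by squares of linear forms\<close>

locale square_cycle =
  fixes n :: nat and c :: "nat \<Rightarrow> 'v" and a :: "nat \<Rightarrow> 'k::field"
  assumes n3: "n \<ge> 3" and inj_c: "inj_on c {..<n}"
begin

sublocale cycle_labels n c "\<lambda>i. lin_form (a i) ^ 2"
  using n3 inj_c by unfold_locales auto

lemma homogeneous_const_vec: "homogeneous_vec 0 (const_vec :: 'v \<Rightarrow> 'k poly poly)"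
  using homogeneous_scalar[where a = 1] by (auto simp: homogeneous_vec_def const_vec_def of_bool_def)

lemma homogeneous_partial_sums:
  assumes "\<And>j. homogeneous_poly d (h j)"
  shows "homogeneous_vec (2 + d) (partial_sums h)"
  unfolding homogeneous_vec_def partial_sums_def
  using homogeneous_poly_mult[OF homogeneous_lin_form_square assms]
  by (auto intro!: homogeneous_poly_sum)

text \<open>The labels contribute degree 2 to every jump. The relations off \<open>T\<close> have
  scalar coefficients and give splines of degree 2, while a syzygy of degree \<open>e s\<close> on
  \<open>T\<close> gives one of degree \<open>2 + e s\<close>.\<close>

lemma homogeneous_spline_basis:
  fixes l :: "nat \<Rightarrow> nat \<Rightarrow> 'k" and e :: "nat \<Rightarrow> nat"
  assumes T: "T \<subseteq> {..<n}" "i0 \<in> T"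
    and l: "\<And>i. i \<in> {..<n} - T \<Longrightarrow>
      lin_form (a i) ^ 2 = (\<Sum>t\<in>T. lin_form (a t) ^ 2 * scalar (l i t))"
    and k_hom: "\<And>s t. homogeneous_poly (e s) (k s t)"
    and k_syz: "\<And>s. s \<in> T - {i0} \<Longrightarrow> (\<Sum>t\<in>T. lin_form (a t) ^ 2 * k s t) = 0"
    and k_gen: "\<And>f. (\<Sum>t\<in>T. lin_form (a t) ^ 2 * f t) = 0 \<Longrightarrow>
        \<exists>r. \<forall>t\<in>T. f t = (\<Sum>s\<in>T - {i0}. r s * k s t)"
    and k_indep: "\<And>r s. (\<And>t. t \<in> T \<Longrightarrow> (\<Sum>s\<in>T - {i0}. r s * k s t) = 0) \<Longrightarrow>
        s \<in> T - {i0} \<Longrightarrow> r s = 0"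
  defines "\<delta> \<equiv> \<lambda>i. if i = i0 then 0 else if i \<in> T then 2 + e i else 2"
  shows "\<exists>B. module_basis spline_module B \<and> homogeneous_set B \<and> finite B \<and>
    degree_list B = map (\<lambda>j. card {i \<in> {..<n}. \<delta> i = j}) [0..<Suc (Max (\<delta> ` {..<n}))]"
proof -
  define g where "g = extend_syzygies T (\<lambda>i t. scalar (l i t)) k"
  define b where "b = (\<lambda>i. if i = i0 then const_vec else partial_sums (g i))"
  have basis: "module_basis spline_module (b ` {..<n})" and inj: "inj_on b {..<n}"
    unfolding b_def g_def by (rule extend_syzygies_basis[OF T]; fact l k_syz k_gen k_indep)+
  have g_hom: "homogeneous_poly (if i \<in> T then e i else 0) (g i j)" for i j
    using homogeneous_scalar[of 1] homogeneous_scalar k_hom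
    by (auto simp: g_def extend_syzygies_def intro: homogeneous_poly_uminus)
  have hom: "homogeneous_vec (\<delta> i) (b i)" for i
    using homogeneous_const_vec homogeneous_partial_sums[of _ "g i", OF g_hom]
    by (auto simp: \<delta>_def b_def numeral_2_eq_2 split: if_splits)
  have "\<not> module.dependent vec_scale (b ` {..<n})"
    using basis by (simp add: module_basis_def)
  \<comment> \<open>Independence excludes the zero vector, which is homogeneous of every degree and
    so has no determined degree.\<close>
  then have "0 \<notin> b ` {..<n}" using vec.dependent_zero[of "b ` {..<n}"] by argo
  then have "b i \<noteq> 0" if "i \<in> {..<n}" for i
    using that by (intro notI) (drule imageI[of _ _ b], simp only: not_True_eq_False)
  then have deg: "vec_degree (b i) = \<delta> i" if "i \<in> {..<n}" for i
    by (rule vec_degree_eqI[OF hom]) (use that in blast)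
  have "homogeneous_set (b ` {..<n})"
    using hom by (auto simp: homogeneous_set_def)
  with basis degree_list_family[OF inj deg] show ?thesis
    by (intro exI[of _ "b ` {..<n}"] conjI finite_imageI finite_lessThan)
qed

text \<open>With \<open>T = {0}\<close> a single nonzero label has no nonzero syzygy, so only the
  relations with coefficient 1 off \<open>T\<close> occur.\<close>

lemma one_label_basis:
  assumes "\<And>i. i < n \<Longrightarrow> a i = a 0"
  shows "\<exists>B. module_basis spline_module B \<and> homogeneous_set B \<and> finite B \<and>
    degree_list B = [1, 0, n - 1]"
proof -
  define \<delta> :: "nat \<Rightarrow> nat" where "\<delta> i = (if i = 0 then 0 else if i \<in> {0} then 2 + 0 else 2)" for i
  have "\<exists>B. module_basis spline_module B \<and> homogeneous_set B \<and> finite B \<and>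
    degree_list B = map (\<lambda>j. card {i \<in> {..<n}. \<delta> i = j}) [0..<Suc (Max (\<delta> ` {..<n}))]"
    unfolding \<delta>_def
  proof (rule homogeneous_spline_basis[where l = "\<lambda>i t. 1" and k = "\<lambda>s t. 0"])
    show "lin_form (a i) ^ 2 = (\<Sum>t\<in>{0}. lin_form (a t) ^ 2 * scalar 1)"
      if "i \<in> {..<n} - {0}" for i
      using assms[of i] that by simp
  qed (use n3 in auto)
  moreover have "map (\<lambda>j. card {i \<in> {..<n}. \<delta> i = j}) [0..<Suc (Max (\<delta> ` {..<n}))]
      = [1, 0, n - 1]"
  proof -
    have max: "Max (\<delta> ` {..<n}) = 2"
      using n3 by (intro Max_eqI) (auto simp: \<delta>_def intro!: image_eqI[of _ _ 1])
    have sets: "{i \<in> {..<n}. \<delta> i = 0} = {0}" "{i \<in> {..<n}. \<delta> i = 1} = {}"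
      "{i \<in> {..<n}. \<delta> i = 2} = {..<n} - {0}"
      using n3 by (auto simp: \<delta>_def)
    have upt: "[0..<Suc 2] = [0, 1, 2]" by (simp add: upt_rec)
    show ?thesis
      unfolding max upt list.map sets using n3 by (simp add: card_Diff_subset)
  qed
  ultimately show ?thesis by simp
qed

text \<open>Here \<open>T\<close> holds one edge for each label. Every further label equals one of
  these two, and the Koszul syzygy, stored at index \<open>j0\<close>, gives the generator of degree
  4.\<close>

lemma two_labels_basis:
  assumes ij: "i0 < n" "j0 < n" "a i0 \<noteq> a j0"
    and two: "\<And>i. i < n \<Longrightarrow> a i = a i0 \<or> a i = a j0"
  shows "\<exists>B. module_basis spline_module B \<and> homogeneous_set B \<and> finite B \<and>
    degree_list B = [1, 0, n - 2, 0, 1]"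
proof -
  have ne: "i0 \<noteq> j0" using ij by auto
  let ?T = "{i0, j0}"
  have T0: "?T - {i0} = {j0}" using ne by auto
  define k where "k s t = (if t = i0 then lin_form (a j0) ^ 2 else - (lin_form (a i0) ^ 2))"
    for s t :: nat
  define \<delta> :: "nat \<Rightarrow> nat" where "\<delta> i = (if i = i0 then 0 else if i \<in> ?T then 2 + 2 else 2)" for i
  have "\<exists>B. module_basis spline_module B \<and> homogeneous_set B \<and> finite B \<and>
    degree_list B = map (\<lambda>j. card {i \<in> {..<n}. \<delta> i = j}) [0..<Suc (Max (\<delta> ` {..<n}))]"
    unfolding \<delta>_def
  proof (rule homogeneous_spline_basis[where l = "\<lambda>i t. of_bool (a i = a t)" and k = k])
    show "\<exists>r. \<forall>t\<in>?T. f t = (\<Sum>s\<in>?T - {i0}. r s * k s t)"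
      if "(\<Sum>t\<in>?T. lin_form (a t) ^ 2 * f t) = 0" for f
    proof -
      have "lin_form (a j0) ^ 2 * - f j0 = lin_form (a i0) ^ 2 * f i0"
        using that ne by (simp add: add_eq_0_iff2)
      then obtain r where "- f j0 = lin_form (a i0) ^ 2 * r" "f i0 = lin_form (a j0) ^ 2 * r"
        using lin_form_square_syzygy ij(3) by blast
      then show ?thesis
        unfolding T0 using ne
        by (intro exI[of _ "\<lambda>_. r"]) (auto simp: k_def mult.commute, metis minus_minus)
    qed
    show "r s = 0" if "\<And>t. t \<in> ?T \<Longrightarrow> (\<Sum>s\<in>?T - {i0}. r s * k s t) = 0" "s \<in> ?T - {i0}"
      for r s
      using that(1)[of i0] that(2) unfolding T0 by (simp add: k_def)
    show "homogeneous_poly 2 (k s t)" for s t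
      by (auto simp: k_def intro: homogeneous_lin_form_square homogeneous_poly_uminus)
  qed (use ij two ne in \<open>auto simp: k_def\<close>)
  moreover have "map (\<lambda>j. card {i \<in> {..<n}. \<delta> i = j}) [0..<Suc (Max (\<delta> ` {..<n}))]
      = [1, 0, n - 2, 0, 1]"
  proof -
    have max: "Max (\<delta> ` {..<n}) = 4"
      using ij ne by (intro Max_eqI) (auto simp: \<delta>_def intro!: image_eqI[of _ _ j0])
    have sets: "{i \<in> {..<n}. \<delta> i = 0} = {i0}" "{i \<in> {..<n}. \<delta> i = 1} = {}"
      "{i \<in> {..<n}. \<delta> i = 2} = {..<n} - {i0, j0}" "{i \<in> {..<n}. \<delta> i = 3} = {}"
      "{i \<in> {..<n}. \<delta> i = 4} = {j0}"
      using ij ne by (auto simp: \<delta>_def)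
    have upt: "[0..<Suc 4] = [0, 1, 2, 3, 4]" by (simp add: upt_rec)
    show ?thesis
      unfolding max upt list.map sets using ij ne by (simp add: card_Diff_subset)
  qed
  ultimately show ?thesis by simp
qed

text \<open>The squares at \<open>i1\<close>, \<open>i2\<close>, \<open>i3\<close> generate all
  others with scalar coefficients by interpolation. The index \<open>i3\<close> serves the constant
  spline, and the two linear syzygies at \<open>i1\<close> and \<open>i2\<close> give the generators
  of degree 3.\<close>

lemma three_labels_basis:
  assumes i: "i1 < n" "i2 < n" "i3 < n" and d: "a i1 \<noteq> a i2" "a i1 \<noteq> a i3" "a i2 \<noteq> a i3"
    and char: "(2::'k) \<noteq> 0"
  shows "\<exists>B. module_basis spline_module B \<and> homogeneous_set B \<and> finite B \<and>
    degree_list B = [1, 0, n - 3, 2]"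
proof -
  have ne: "i1 \<noteq> i2" "i1 \<noteq> i3" "i2 \<noteq> i3" "i2 \<noteq> i1" "i3 \<noteq> i1" "i3 \<noteq> i2" using d by auto
  let ?T = "{i3, i1, i2}"
  have T0: "?T - {i3} = {i1, i2}" using ne by auto
  \<comment> \<open>The affine coordinates of \<open>a i3\<close> with respect to
    \<open>a i1\<close> and \<open>a i2\<close>.\<close>
  define s t where "s = (a i2 - a i3) / (a i2 - a i1)" and "t = (a i3 - a i1) / (a i2 - a i1)"
  have "(a i2 - a i1) * (s + t) = (a i2 - a i1) * 1"
    "(a i2 - a i1) * (s * a i1 + t * a i2) = (a i2 - a i1) * a i3"
    using d by (simp_all add: s_def t_def distrib_left mult.assoc[symmetric]) (simp_all add: algebra_simps)
  then have st: "s + t = 1" "s * a i1 + t * a i2 = a i3" using d by auto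
  have "\<exists>l1 l2 l3. lin_form (a i) ^ 2 = scalar l1 * lin_form (a i1) ^ 2
      + scalar l2 * lin_form (a i2) ^ 2 + scalar l3 * lin_form (a i3) ^ 2" for i
    using lin_form_square_interpolation d by metis
  then obtain l1 l2 l3 where l: "\<And>i. lin_form (a i) ^ 2 = scalar (l1 i) * lin_form (a i1) ^ 2
      + scalar (l2 i) * lin_form (a i2) ^ 2 + scalar (l3 i) * lin_form (a i3) ^ 2"
    by metis
  have sumT: "(\<Sum>t\<in>?T. f t) = f i1 + f i2 + f i3" for f :: "nat \<Rightarrow> 'k poly poly"
    using ne by (simp add: add_ac)
  define k where "k m j =
    (if m = i1 then
       if j = i1 then scalar (2 * s * t) * lin_form (a i2) + scalar (s ^ 2) * lin_form (a i1)
       else if j = i2 then scalar (t ^ 2) * lin_form (a i1) else - lin_form (a i1)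
     else
       if j = i1 then scalar (s ^ 2) * lin_form (a i2)
       else if j = i2 then scalar (2 * s * t) * lin_form (a i1) + scalar (t ^ 2) * lin_form (a i2)
       else - lin_form (a i2))" for m j :: nat
  define \<delta> :: "nat \<Rightarrow> nat" where "\<delta> i = (if i = i3 then 0 else if i \<in> ?T then 2 + 1 else 2)" for i
  have "\<exists>B. module_basis spline_module B \<and> homogeneous_set B \<and> finite B \<and>
    degree_list B = map (\<lambda>j. card {i \<in> {..<n}. \<delta> i = j}) [0..<Suc (Max (\<delta> ` {..<n}))]"
    unfolding \<delta>_def
  proof (rule homogeneous_spline_basis[where k = k and
        l = "\<lambda>i t. if t = i1 then l1 i else if t = i2 then l2 i else l3 i"])
    show "lin_form (a i) ^ 2 = (\<Sum>t\<in>?T. lin_form (a t) ^ 2 *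
        scalar (if t = i1 then l1 i else if t = i2 then l2 i else l3 i))" for i
      using ne by (subst l) (simp add: algebra_simps)
    show "(\<Sum>t\<in>?T. lin_form (a t) ^ 2 * k m t) = 0" if "m \<in> ?T - {i3}" for m
    proof -
      have "m = i1 \<or> m = i2" using that by auto
      then show ?thesis
        unfolding sumT using ne linear_syzygies[OF d char st] by (elim disjE) (simp_all add: k_def)
    qed
    show "\<exists>r. \<forall>t\<in>?T. f t = (\<Sum>m\<in>?T - {i3}. r m * k m t)"
      if "(\<Sum>t\<in>?T. lin_form (a t) ^ 2 * f t) = 0" for f
    proof -
      have "lin_form (a i1) ^ 2 * f i1 + lin_form (a i2) ^ 2 * f i2 + lin_form (a i3) ^ 2 * f i3 = 0"
        using that unfolding sumT .
      from linear_syzygies_span[OF d char st this] obtain r1 r2 where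
        "f i1 = r1 * k i1 i1 + r2 * k i2 i1" "f i2 = r1 * k i1 i2 + r2 * k i2 i2"
        "f i3 = r1 * k i1 i3 + r2 * k i2 i3"
        using ne by (auto simp: k_def)
      then show ?thesis
        unfolding T0 using ne by (intro exI[of _ "\<lambda>m. if m = i1 then r1 else r2"]) auto
    qed
    show "r m = 0" if r: "\<And>t. t \<in> ?T \<Longrightarrow> (\<Sum>m\<in>?T - {i3}. r m * k m t) = 0" and m: "m \<in> ?T - {i3}"
      for r m
    proof -
      have "r i1 = 0" "r i2 = 0"
        using linear_syzygies_independent[OF d char st, of "r i1" "r i2"] r[of i1] r[of i3] ne
        unfolding T0 by (auto simp: k_def)
      then show ?thesis using m unfolding T0 by auto
    qed
    show "homogeneous_poly 1 (k m j)" for m j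
      using homogeneous_lin_form
      by (auto simp: k_def intro!: homogeneous_poly_add homogeneous_poly_uminus
          homogeneous_scalar_mult)
  qed (use i in auto)
  moreover have "map (\<lambda>j. card {i \<in> {..<n}. \<delta> i = j}) [0..<Suc (Max (\<delta> ` {..<n}))]
      = [1, 0, n - 3, 2]"
  proof -
    have max: "Max (\<delta> ` {..<n}) = 3"
      using i ne by (intro Max_eqI) (auto simp: \<delta>_def intro!: image_eqI[of _ _ i1])
    have sets: "{i \<in> {..<n}. \<delta> i = 0} = {i3}" "{i \<in> {..<n}. \<delta> i = 1} = {}"
      "{i \<in> {..<n}. \<delta> i = 2} = {..<n} - {i1, i2, i3}" "{i \<in> {..<n}. \<delta> i = 3} = {i1, i2}"
      using i ne by (auto simp: \<delta>_def)
    have upt: "[0..<Suc 3] = [0, 1, 2, 3]" by (simp add: upt_rec)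
    show ?thesis
      unfolding max upt list.map sets using i ne by (simp add: card_Diff_subset)
  qed
  ultimately show ?thesis by simp
qed

end

text \<open>The third case asks for \<open>2 \<noteq> 0\<close>: in characteristic 2 the squares are
  \<open>x^2 + a^2 y^2\<close>, so any two distinct ones span all others and the degrees of the
  two-label case would persist.\<close>

theorem corollary4p16:
  fixes n :: nat
    and V :: "'v set"
    and E :: "'v set set"
    and \<alpha> :: "'v set \<Rightarrow> 'k::field poly poly set"
  assumes "cycle_graph n V E"
    and "\<alpha> \<in> E \<rightarrow> linear_square_ideals"
  shows "(card (\<alpha> ` E) = 1 \<longrightarrow>
            (\<exists>B. module_basis (splines V E \<alpha>) B \<and> homogeneous_set B \<and> finite B \<and>
                 degree_list B = [1, 0, n - 1]) \<and>
            has_degree_sequence V E \<alpha> [1, 0, n - 1]) \<and>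
         (card (\<alpha> ` E) = 2 \<longrightarrow>
            (\<exists>B. module_basis (splines V E \<alpha>) B \<and> homogeneous_set B \<and> finite B \<and>
                 degree_list B = [1, 0, n - 2, 0, 1]) \<and>
            has_degree_sequence V E \<alpha> [1, 0, n - 2, 0, 1]) \<and>
         (card (\<alpha> ` E) \<ge> 3 \<and> (2::'k) \<noteq> 0 \<longrightarrow>
            (\<exists>B. module_basis (splines V E \<alpha>) B \<and> homogeneous_set B \<and> finite B \<and>
                 degree_list B = [1, 0, n - 3, 2]) \<and>
            has_degree_sequence V E \<alpha> [1, 0, n - 3, 2])"
proof -
  obtain c where n: "n \<ge> 3" and c: "bij_betw c {..<n} V"
    and E: "E = (\<lambda>i. {c i, c (Suc i mod n)}) ` {..<n}"
    using assms(1) by (auto simp: cycle_graph_def)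
  define ideal :: "'k \<Rightarrow> 'k poly poly set" where
    "ideal x = module.span (*) {lin_form x ^ 2}" for x
  define edge where "edge i = {c i, c (Suc i mod n)}" for i
  have "\<exists>x. I = ideal x" if "I \<in> linear_square_ideals" for I
    using that by (auto simp: linear_square_ideals_def ideal_def lin_form_def)
  \<comment> \<open>The parameter is chosen per ideal, not per edge. Equal labels thus get equal
    parameters, which later makes \<open>ideal\<close> injective on the parameters that
    occur.\<close>
  then obtain x where x: "\<And>I. I \<in> linear_square_ideals \<Longrightarrow> I = ideal (x I)" by metis
  define a where "a i = x (\<alpha> (edge i))" for i
  have \<alpha>: "\<alpha> (edge i) = ideal (a i)" if "i < n" for i
    using that assms(2) x by (auto simp: a_def E edge_def)
  interpret square_cycle n c a
    using n c by unfold_locales (auto simp: bij_betw_def)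
  have V: "V = c ` {..<n}" using c by (simp add: bij_betw_def)
  have edge_iff: "(\<forall>u v. {u, v} \<in> E \<longrightarrow> p u - p v \<in> \<alpha> {u, v}) \<longleftrightarrow>
      (\<forall>i<n. lin_form (a i) ^ 2 dvd p (c (Suc i mod n)) - p (c i))" for p
  proof -
    \<comment> \<open>An unordered edge can be read in two directions; the difference then changes
      sign, which divisibility ignores.\<close>
    have mem: "p u - p v \<in> \<alpha> (edge i) \<longleftrightarrow> lin_form (a i) ^ 2 dvd p (c (Suc i mod n)) - p (c i)"
      if "i < n" "{u, v} = edge i" for i u v
      using that \<alpha>[OF that(1)]
        dvd_minus_iff[of "lin_form (a i) ^ 2" "p (c (Suc i mod n)) - p (c i)"]
      by (auto simp: ideal_def span_singleton_eq_dvd edge_def doubleton_eq_iff)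
    show ?thesis
    proof (intro iffI allI impI)
      fix i assume "\<forall>u v. {u, v} \<in> E \<longrightarrow> p u - p v \<in> \<alpha> {u, v}" "i < n"
      then show "lin_form (a i) ^ 2 dvd p (c (Suc i mod n)) - p (c i)"
        using mem[of i "c i" "c (Suc i mod n)"] by (auto simp: E edge_def)
    next
      fix u v assume h: "\<forall>i<n. lin_form (a i) ^ 2 dvd p (c (Suc i mod n)) - p (c i)" and "{u, v} \<in> E"
      then obtain i where "i < n" "{u, v} = edge i" by (auto simp: E edge_def)
      then show "p u - p v \<in> \<alpha> {u, v}" using h mem by metis
    qed
  qed
  have splines: "splines V E \<alpha> = spline_module"
    unfolding splines_def spline_module_def edge_iff V ..
  have "\<alpha> ` E = ideal ` a ` {..<n}"
    using \<alpha> by (auto simp: E image_image edge_def)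
  moreover have "inj_on ideal (a ` {..<n})"
    using \<alpha> by (auto simp: inj_on_def a_def)
  ultimately have card: "card (\<alpha> ` E) = card (a ` {..<n})"
    by (simp add: card_image)
  have one: "\<exists>B. module_basis (splines V E \<alpha>) B \<and> homogeneous_set B \<and> finite B \<and>
      degree_list B = [1, 0, n - 1]" if labels: "card (\<alpha> ` E) = 1"
    unfolding splines
  proof (rule one_label_basis)
    obtain z where "a ` {..<n} = {z}"
      using labels card by (auto simp: card_1_singleton_iff)
    then have "a i = z" if "i < n" for i using that by blast
    then show "a i = a 0" if "i < n" for i using that n by simp
  qed
  have two: "\<exists>B. module_basis (splines V E \<alpha>) B \<and> homogeneous_set B \<and> finite B \<and>
      degree_list B = [1, 0, n - 2, 0, 1]" if labels: "card (\<alpha> ` E) = 2"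
  proof -
    obtain y z where yz: "a ` {..<n} = {y, z}" "y \<noteq> z"
      using labels card by (auto simp: card_2_iff)
    then have "y \<in> a ` {..<n}" "z \<in> a ` {..<n}" by auto
    then obtain i j where ij: "i < n" "a i = y" "j < n" "a j = z" by auto
    show ?thesis
      unfolding splines by (rule two_labels_basis[of i j]) (use ij yz in auto)
  qed
  have three: "\<exists>B. module_basis (splines V E \<alpha>) B \<and> homogeneous_set B \<and> finite B \<and>
      degree_list B = [1, 0, n - 3, 2]" if labels: "card (\<alpha> ` E) \<ge> 3" and char: "(2::'k) \<noteq> 0"
  proof -
    obtain S where S: "S \<subseteq> a ` {..<n}" "card S = 3"
      using labels unfolding card by (rule obtain_subset_with_card_n)
    then obtain w y z where wyz: "S = {w, y, z}" "w \<noteq> y" "w \<noteq> z" "y \<noteq> z"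
      by (auto simp: card_3_iff)
    then have "w \<in> a ` {..<n}" "y \<in> a ` {..<n}" "z \<in> a ` {..<n}" using S by auto
    then obtain i j m where ijm: "i < n" "a i = w" "j < n" "a j = y" "m < n" "a m = z" by auto
    show ?thesis
      unfolding splines by (rule three_labels_basis[of i j m]) (use ijm wyz char in auto)
  qed
  have seq: "has_degree_sequence V E \<alpha> ds"
    if "\<exists>B. module_basis (splines V E \<alpha>) B \<and> homogeneous_set B \<and> finite B \<and> degree_list B = ds" for ds
  proof -
    obtain B where "module_basis (splines V E \<alpha>) B" "homogeneous_set B" "finite B" "degree_list B = ds"
      using \<open>\<exists>B. _\<close> by blast
    then show ?thesis using has_degree_sequence_if_homogeneous_basis by blast
  qed
  show ?thesis
    by (intro conjI impI; (erule conjE)?; (rule seq)?; rule one two three; assumption)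
qed

end
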